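(* Let $0<\mu\le L$, $\varrho=\mu/L$, and $\sigma\in[0,1)$. Consider the DIGing algorithm $$x_i(k+1)=\sum_{j\in\mathcal N_i}w_{ij}x_j(k)-\alpha y_i(k),\qquad y_i(k+1)=\sum_{j\in\mathcal N_i}w_{ij}y_j(k)+\nabla f_i(x_i(k+1))-\nabla f_i(x_i(k)),\qquad i=1,\dots,N,$$ with $x_i(0)\in\mathbb R^d$ arbitrary and $y_i(0)=\nabla f_i(x_i(0))$, for the class $\mathcal F_{\mu,L}$ of objective functions over the class $\{\mathcal G\}_\sigma$ of graphs. Let $\gamma(\alpha)$ be its worst-case convergence rate with step size $\alpha$. Then the optimal worst-case convergence rate $\min_{\alpha>0}\gamma(\alpha)$ equals $$\gamma_{DG}^{*}=\frac{\sigma\varrho+\sqrt{1+\varrho-\sigma^2\varrho}}{1+\varrho},$$ and it is attained with the step size $\alpha_{DG}^{*}=\dfrac{1-\gamma_{DG}^{*}}{\mu}$.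
   Context: The problem is $\min_{x\in\mathbb R^d}\sum_{i=1}^N f_i(x)$ with $N\ge 2$ agents, agent $i$ holding a local copy $x_i\in\mathbb R^d$ and an auxiliary variable $y_i\in\mathbb R^d$. Write $\boldsymbol x=(x_1,\dots,x_N)\in\mathbb R^{Nd}$ and $\boldsymbol f(\boldsymbol x)=\sum_{i=1}^N f_i(x_i)$. Function class: $\boldsymbol f\in\mathcal F_{\mu,L}$ means that each $f_i:\mathbb R^d\to\mathbb R$ is differentiable, $\mu$-strongly convex and $L$-smooth, i.e. for all $x,y\in\mathbb R^d$: $f_i(x)+\nabla f_i(x)^T(y-x)+\frac{\mu}{2}\|y-x\|^2\le f_i(y)\le f_i(x)+\nabla f_i(x)^T(y-x)+\frac L2\|y-x\|^2$. Graph class: a graph $\mathcal G$ is an undirected graph on $N$ nodes with adjacency (weight) matrix $W=(w_{ij})\in\mathbb R^{N\times N}$, where $w_{ij}>0$ if $j\in\mathcal N_i$ (the neighbour set of $i$) and $w_{ij}=0$ otherwise, such that $W=W^T$, $W\mathbf 1=\mathbf 1$, and $\|W\|_s:=\rho\left(W-\frac{\mathbf 1\mathbf 1^T}{N}\right)<1$ ($\rho$ = spectral radius). $\{\mathcal G\}_\sigma$ is the set of all such (connected) graphs with $\|W\|_s\le\sigma$. Worst-case rate: the algorithm with step size $\alpha$ is said to converge at the worst-case convergence rate $\gamma$ if $\lim_{k\to\infty}r^{-k}(\boldsymbol x(k)-\boldsymbol x^* )=\mathbf 0$ for all $r\in(\gamma,1]$, for every $\boldsymbol f\in\mathcal F_{\mu,L}$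 and every $\mathcal G\in\{\mathcal G\}_\sigma$ (and every initialization as specified), where $\boldsymbol x^*=\mathbf 1_N\otimes x^*$ is the stationary point, $x^*$ being the minimizer of $\sum_i f_i$. $\gamma(\alpha)$ denotes the smallest $\gamma\in[0,1)$ with this property (and $\gamma(\alpha)$ is not less than $1$ if there is none). *)

theory Defs
  imports "HOL-Analysis.Analysis" "Jordan_Normal_Form.Spectral_Radius"
begin

text \<open>
  Agents are the indices \<open>i < N\<close>, and \<open>\<real>\<^sup>d\<close> is an arbitrary Euclidean space \<open>'a\<close>
  (so \<open>d = DIM('a) \<ge> 1\<close>). A stacked vector is a function \<open>nat \<Rightarrow> 'a\<close> of which only
  the values at \<open>i < N\<close> matter.
\<close>

text \<open>Only meaningful at points where \<open>f\<close> is differentiable.\<close>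

definition gradient :: "('a::euclidean_space \<Rightarrow> real) \<Rightarrow> 'a \<Rightarrow> 'a" where
  "gradient f x = (THE D. GDERIV f x :> D)"

definition objective_class ::
    "nat \<Rightarrow> real \<Rightarrow> real \<Rightarrow> (nat \<Rightarrow> 'a::euclidean_space \<Rightarrow> real) set" where
  "objective_class N \<mu> L = {f. \<forall>i<N.
     (\<forall>x. f i differentiable (at x)) \<and>
     (\<forall>x y. f i x + gradient (f i) x \<bullet> (y - x) + \<mu> / 2 * (norm (y - x))\<^sup>2 \<le> f i y \<and>
            f i y \<le> f i x + gradient (f i) x \<bullet> (y - x) + L / 2 * (norm (y - x))\<^sup>2)}"

text \<open>The spectral radius of \<open>W - \<one>\<one>\<^sup>T / N\<close>.\<close>

definition mixing_norm :: "nat \<Rightarrow> real mat \<Rightarrow> real" where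
  "mixing_norm N W =
     spectral_radius (map_mat complex_of_real (W - mat N N (\<lambda>_. 1 / real N)))"

text \<open>
  \<open>Nb i\<close> is the neighbour set of agent \<open>i\<close>. An agent may be its own neighbour: the
  update of agent \<open>i\<close> only sums over \<open>Nb i\<close>, so the diagonal weights enter through it,
  and without them there would be no weight matrix at all for \<open>N = 2\<close>.
  Symmetry of \<open>W\<close> makes the graph undirected; connectedness is a consequence of
  \<open>mixing_norm N W < 1\<close>.
\<close>

definition graph_class :: "nat \<Rightarrow> real \<Rightarrow> ((nat \<Rightarrow> nat set) \<times> real mat) set" where
  "graph_class N \<sigma> = {(Nb, W).
     W \<in> carrier_mat N N \<and>
     (\<forall>i<N. Nb i \<subseteq> {..<N}) \<and>
     (\<forall>i<N. \<forall>j<N. (j \<in> Nb i \<longrightarrow> W $$ (i, j) > 0) \<and> (j \<notin> Nb i \<longrightarrow> W $$ (i, j) = 0)) \<and>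
     transpose_mat W = W \<and>
     W *\<^sub>v vec N (\<lambda>_. 1) = vec N (\<lambda>_. 1) \<and>
     mixing_norm N W < 1 \<and>
     mixing_norm N W \<le> \<sigma>}"

text \<open>\<open>x k i\<close> and \<open>y k i\<close> are the variables of agent \<open>i\<close> at iteration \<open>k\<close>.\<close>

definition DIGing ::
    "nat \<Rightarrow> (nat \<Rightarrow> nat set) \<Rightarrow> real mat \<Rightarrow> (nat \<Rightarrow> 'a::euclidean_space \<Rightarrow> real) \<Rightarrow> real \<Rightarrow>
     (nat \<Rightarrow> nat \<Rightarrow> 'a) \<Rightarrow> (nat \<Rightarrow> nat \<Rightarrow> 'a) \<Rightarrow> bool" where
  "DIGing N Nb W f \<alpha> x y \<longleftrightarrow>
     (\<forall>i<N. y 0 i = gradient (f i) (x 0 i)) \<and>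
     (\<forall>k. \<forall>i<N.
        x (Suc k) i = (\<Sum>j\<in>Nb i. W $$ (i, j) *\<^sub>R x k j) - \<alpha> *\<^sub>R y k i \<and>
        y (Suc k) i = (\<Sum>j\<in>Nb i. W $$ (i, j) *\<^sub>R y k j)
                      + gradient (f i) (x (Suc k) i) - gradient (f i) (x k i))"

text \<open>
  The first argument only fixes the space \<open>'a\<close>. A minimizer \<open>xs\<close> of the sum exists and is
  unique for \<open>0 < \<mu>\<close> and \<open>0 < N\<close>. Convergence in \<open>\<real>\<^sup>N\<^sup>d\<close> is stated blockwise.
\<close>

definition DIGing_converges_at ::
    "'a::euclidean_space itself \<Rightarrow> nat \<Rightarrow> real \<Rightarrow> real \<Rightarrow> real \<Rightarrow> real \<Rightarrow> real \<Rightarrow> bool" where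
  "DIGing_converges_at _ N \<mu> L \<sigma> \<alpha> \<gamma> \<longleftrightarrow>
     (\<forall>(f :: nat \<Rightarrow> 'a \<Rightarrow> real) \<in> objective_class N \<mu> L.
      \<forall>(Nb, W) \<in> graph_class N \<sigma>.
      \<forall>x y xs. DIGing N Nb W f \<alpha> x y \<longrightarrow>
        is_arg_min (\<lambda>z. \<Sum>i<N. f i z) (\<lambda>_. True) xs \<longrightarrow>
        (\<forall>r\<in>{\<gamma><..1}. \<forall>i<N. (\<lambda>k. inverse (r ^ k) *\<^sub>R (x k i - xs)) \<longlonglongrightarrow> 0))"

text \<open>
  The admissible \<open>\<gamma>\<close> form an interval that is closed from below, so the \<open>LEAST\<close> is
  attained as soon as there is one; otherwise the rate is set to \<open>1\<close>.
\<close>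

definition DIGing_rate ::
    "'a::euclidean_space itself \<Rightarrow> nat \<Rightarrow> real \<Rightarrow> real \<Rightarrow> real \<Rightarrow> real \<Rightarrow> real" where
  "DIGing_rate T N \<mu> L \<sigma> \<alpha> =
     (if \<exists>\<gamma>\<in>{0..<1}. DIGing_converges_at T N \<mu> L \<sigma> \<alpha> \<gamma>
      then (LEAST \<gamma>. \<gamma> \<in> {0..<1} \<and> DIGing_converges_at T N \<mu> L \<sigma> \<alpha> \<gamma>)
      else 1)"

lemma DIGing_rate_least:
  assumes "\<gamma>0 \<in> {0..<1}" "DIGing_converges_at T N \<mu> L \<sigma> \<alpha> \<gamma>0"
  shows "DIGing_rate T N \<mu> L \<sigma> \<alpha> \<in> {0..<1}"
    and "DIGing_converges_at T N \<mu> L \<sigma> \<alpha> (DIGing_rate T N \<mu> L \<sigma> \<alpha>)"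
    and "DIGing_rate T N \<mu> L \<sigma> \<alpha> \<le> \<gamma>0"
proof -
  let ?P = "\<lambda>\<gamma>. \<gamma> \<in> {0..<1} \<and> DIGing_converges_at T N \<mu> L \<sigma> \<alpha> \<gamma>"
  define m where "m = Inf (Collect ?P)"
  have P0: "?P \<gamma>0" using assms by simp
  have bdd: "bdd_below (Collect ?P)" by (rule bdd_belowI[of _ 0]) auto
  have low: "m \<le> \<gamma>" if "?P \<gamma>" for \<gamma>
    unfolding m_def using that bdd by (intro cInf_lower) auto
  have m0: "0 \<le> m" unfolding m_def using P0 by (intro cInf_greatest) auto
  have m1: "m < 1" using low[OF P0] P0 by auto
  have above: "\<exists>\<gamma>. ?P \<gamma> \<and> \<gamma> < r" if "m < r" for r
    using cInf_lessD[of "Collect ?P" r] that P0 unfolding m_def by blast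
  have conv: "DIGing_converges_at T N \<mu> L \<sigma> \<alpha> m"
    unfolding DIGing_converges_at_def
  proof (clarify, goal_cases)
    case (1 f Nb W x y xs r i)
    then obtain \<gamma> where g: "?P \<gamma>" "\<gamma> < r" using above[of r] by auto
    then have "DIGing_converges_at T N \<mu> L \<sigma> \<alpha> \<gamma>" by blast
    then show ?case
      using 1 g(2) unfolding DIGing_converges_at_def by fastforce
  qed
  have "?P m" using m0 m1 conv by simp
  then have "(LEAST \<gamma>. ?P \<gamma>) = m" using low by (intro Least_equality) auto
  then have rm: "DIGing_rate T N \<mu> L \<sigma> \<alpha> = m"
    unfolding DIGing_rate_def using assms by auto
  show "DIGing_rate T N \<mu> L \<sigma> \<alpha> \<in> {0..<1}"
    and "DIGing_converges_at T N \<mu> L \<sigma> \<alpha> (DIGing_rate T N \<mu> L \<sigma> \<alpha>)"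
    and "DIGing_rate T N \<mu> L \<sigma> \<alpha> \<le> \<gamma>0"
    unfolding rm using m0 m1 conv low[OF P0] by auto
qed

end

theory Submission
  imports Defs
begin

text \<open>
  Write \<open>g\<close> for the claimed rate. It is the root in \<open>(\<sigma>, 1)\<close> of \<open>1 - g\<^sup>2 = \<rho> * (g - \<sigma>)\<^sup>2\<close>, and the claimed
  step size is the one with \<open>\<alpha> * \<mu> = 1 - g\<close> and \<open>\<alpha> * L * (1 + g) = (g - \<sigma>)\<^sup>2\<close>. The two equations
  balance two worst cases, both with identical quadratic objectives \<open>h / 2 * (norm z)\<^sup>2\<close>. If all agents start
  at the same point and \<open>h = \<mu>\<close>, the errors are multiplied by \<open>1 - \<alpha> * \<mu>\<close> in each step, which rules
  out step sizes below the claimed one. If \<open>h = L\<close> and \<open>W\<close> has the eigenvalue \<open>- \<sigma>\<close>, the error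
  along an eigenvector obeys a linear recurrence with characteristic polynomial
  \<open>(z + \<sigma>)\<^sup>2 + \<alpha> * L * (z - 1)\<close>. For step sizes above the claimed one it is negative at \<open>- g\<close>, so
  it has a root below \<open>- g\<close>. These are the lemmas \<open>consensus_mode_bound\<close> and
  \<open>alternating_mode_bound\<close>.

  For the upper bound, let \<open>e\<close> be the error and \<open>u\<close> the difference of the gradients at the
  iterate and at the minimizer. Strong convexity and smoothness give the sector inequality
  \<open>inner (u - \<mu> *\<^sub>R e) (u - L *\<^sub>R e) \<le> 0\<close> for every agent. Summed over the agents, its left-hand side
  is invariant under orthogonal changes of coordinates, so it can be read in an orthonormal
  eigenbasis of \<open>W\<close>, in which the linear part of the algorithm decouples into scalar modes.
  In the mode of an eigenvalue \<open>\<nu> \<noteq> 1\<close> there is a sequence \<open>\<xi>\<close> such that, with \<open>z\<close> for the shift,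
  \<open>u - h *\<^sub>R e\<close> is the polynomial \<open>(z - \<nu>)\<^sup>2 + \<alpha> * h * (z - 1)\<close> in the shift applied to \<open>\<xi>\<close>. Expanded
  in \<open>(z - r)\<^sup>2\<close>, \<open>z\<^sup>2 - r\<^sup>2\<close> and \<open>(z + r)\<^sup>2\<close>, this polynomial has positive coefficients for every
  \<open>h\<close> between \<open>\<mu>\<close> and \<open>L\<close> as soon as \<open>r > g\<close>; the extreme case is its value at \<open>z = - r\<close> for \<open>h = L\<close> and
  \<open>\<nu> = - \<sigma>\<close>, the worst case above. This positivity yields a positive definite quadratic form \<open>V\<close> in
  \<open>\<xi>\<close> whose increase over \<open>r\<^sup>2 * V\<close> is at most the contribution of the mode to the sector
  inequality (\<open>storage_dissipation\<close>, \<open>disagreement_mode_lyapunov\<close>). The consensus mode \<open>\<nu> = 1\<close>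
  is of first order and simpler (\<open>consensus_mode_lyapunov\<close>). The sum of the forms over all modes
  therefore shrinks by \<open>r\<^sup>2\<close> in each step, for every \<open>r > g\<close> (\<open>DIGing_geometric_decay\<close>).
\<close>

section \<open>The sector condition for gradients\<close>

text \<open>
  With \<open>D\<close> the difference of the gradients minus \<open>\<mu> *\<^sub>R (x - y)\<close>, the claim is that the gradient of
  \<open>f\<close> minus \<open>\<mu> / 2\<close> times the squared norm is cocoercive. The lower bound based at one of the two
  points and the upper bound based at the other are compared at a point reached by a step of
  length \<open>t\<close> along \<open>D\<close>; adding the two comparisons eliminates the function values, and
  \<open>t = 1 / (L - \<mu>)\<close> is optimal if \<open>\<mu> < L\<close>, while large \<open>t\<close> give \<open>D = 0\<close> if \<open>\<mu> = L\<close>.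
\<close>

lemma cocoercivity_sector:
  fixes f :: "'a::real_inner \<Rightarrow> real" and G :: "'a \<Rightarrow> 'a"
  assumes lower: "\<And>x y. f x + inner (G x) (y - x) + \<mu> / 2 * (norm (y - x))\<^sup>2 \<le> f y"
    and upper: "\<And>x y. f y \<le> f x + inner (G x) (y - x) + L / 2 * (norm (y - x))\<^sup>2"
    and "\<mu> \<le> L"
  shows "inner ((G x - G y) - \<mu> *\<^sub>R (x - y)) ((G x - G y) - L *\<^sub>R (x - y)) \<le> 0"
proof -
  define e where "e = x - y"
  define D where "D = (G x - G y) - \<mu> *\<^sub>R e"
  define K where "K = L - \<mu>"
  have K: "K \<ge> 0" using assms(3) by (simp add: K_def)
  have x: "x = y + e" by (simp add: e_def)
  have Gx: "G x = G y + D + \<mu> *\<^sub>R e" by (simp add: D_def)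
  have key: "(2 * t - K * t\<^sup>2) * inner D D \<le> inner D e" for t
  proof -
    have 1: "f y + inner (G y) (e - t *\<^sub>R D) + \<mu> / 2 * (norm (e - t *\<^sub>R D))\<^sup>2
          \<le> f x + inner (G x) (- t *\<^sub>R D) + L / 2 * (norm (- t *\<^sub>R D))\<^sup>2"
      using lower[of y "x - t *\<^sub>R D"] upper[of "x - t *\<^sub>R D" x] by (simp add: e_def algebra_simps)
    have 2: "f x + inner (G x) (t *\<^sub>R D - e) + \<mu> / 2 * (norm (t *\<^sub>R D - e))\<^sup>2
          \<le> f y + inner (G y) (t *\<^sub>R D) + L / 2 * (norm (t *\<^sub>R D))\<^sup>2"
      using lower[of x "y + t *\<^sub>R D"] upper[of "y + t *\<^sub>R D" y] by (simp add: e_def algebra_simps)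
    have sq: "(norm (e - t *\<^sub>R D))\<^sup>2 = inner e e - 2 * t * inner D e + t\<^sup>2 * inner D D"
      "(norm (t *\<^sub>R D - e))\<^sup>2 = inner e e - 2 * t * inner D e + t\<^sup>2 * inner D D"
      "(norm (t *\<^sub>R D))\<^sup>2 = t\<^sup>2 * inner D D" "(norm (- t *\<^sub>R D))\<^sup>2 = t\<^sup>2 * inner D D"
      unfolding power2_norm_eq_inner
      by (simp_all add: inner_diff_left inner_diff_right inner_commute[of e D] power2_eq_square algebra_simps)
    have Gin: "inner (G x) v = inner (G y) v + inner D v + \<mu> * inner e v" for v
      unfolding Gx by (simp add: inner_add_left)
    show ?thesis using 1 2 unfolding sq Gin K_def
      by (simp add: inner_diff_right inner_commute[of e D] algebra_simps)
  qed
  have "inner D D \<le> K * inner D e"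
  proof (cases "K = 0")
    case True
    have "inner D D \<le> 0"
    proof (rule ccontr)
      assume "\<not> ?thesis"
      then have pos: "inner D D > 0" by (simp only: not_le)
      then have "inner D D \<noteq> 0" by linarith
      then have "(2 * ((\<bar>inner D e\<bar> + 1) / inner D D)) * inner D D = 2 * (\<bar>inner D e\<bar> + 1)" by auto
      then show False using key[of "(\<bar>inner D e\<bar> + 1) / inner D D"] True by auto
    qed
    then show ?thesis using True by simp
  next
    case False
    then have "K > 0" using K by simp
    then show ?thesis using key[of "1 / K"] by (simp add: power2_eq_square field_simps)
  qed
  then have "inner D (D - K *\<^sub>R e) \<le> 0" by (simp add: inner_simps)
  moreover have "D - K *\<^sub>R e = (G x - G y) - L *\<^sub>R e" by (simp add: D_def K_def algebra_simps)
  ultimately have "inner D ((G x - G y) - L *\<^sub>R e) \<le> 0" by (simp only:)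
  then show ?thesis by (simp only: D_def e_def)
qed

text \<open>
  Otherwise a short step against \<open>g\<close> would decrease the quadratic upper bound below \<open>F x\<close>.
\<close>

lemma gradient_zero_at_minimizer:
  fixes F :: "'a::real_inner \<Rightarrow> real"
  assumes upper: "\<And>z. F z \<le> F x + inner g (z - x) + C * (norm (z - x))\<^sup>2"
    and min: "\<And>z. F x \<le> F z"
  shows "g = 0"
proof (rule ccontr)
  assume "g \<noteq> 0"
  then have g: "inner g g > 0" by simp
  define t where "t = 1 / (\<bar>C\<bar> + 1)"
  have t: "t > 0" by (simp add: t_def)
  have "F x \<le> F x + inner g (- t *\<^sub>R g) + C * (norm (- t *\<^sub>R g))\<^sup>2"
    using upper[of "x - t *\<^sub>R g"] min[of "x - t *\<^sub>R g"] by simp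
  then have "t * inner g g \<le> t * (C * t * inner g g)"
    by (simp add: power_mult_distrib power2_norm_eq_inner[symmetric] power2_eq_square mult_ac)
  then have "inner g g \<le> (C * t) * inner g g" using t by simp
  moreover have "C * t < 1" unfolding t_def by (simp add: field_simps)
  ultimately show False using g by (simp add: mult_le_cancel_right1)
qed

section \<open>Quadratic storage functions\<close>

text \<open>
  Completing the square in \<open>X\<close>. This turns \<open>p * q > s\<^sup>2\<close> into coercivity of the form, in \<open>Y\<close> directly
  and in \<open>X\<close> after exchanging the roles.
\<close>

lemma definite_quadratic_form:
  fixes X Y :: "'a::real_inner"
  shows "(p * q - s\<^sup>2) * (norm Y)\<^sup>2 \<le> p * (p * (norm X)\<^sup>2 + q * (norm Y)\<^sup>2 + 2 * s * inner X Y)"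
proof -
  have "p * (p * (norm X)\<^sup>2 + q * (norm Y)\<^sup>2 + 2 * s * inner X Y)
      = (norm (p *\<^sub>R X + s *\<^sub>R Y))\<^sup>2 + (p * q - s\<^sup>2) * (norm Y)\<^sup>2"
    unfolding power2_norm_eq_inner
    by (simp add: inner_simps algebra_simps inner_commute power2_eq_square)
  then show ?thesis by simp
qed

text \<open>
  The polynomials \<open>E2 * (z - r)\<^sup>2 + E1 * (z\<^sup>2 - r\<^sup>2) + E0 * (z + r)\<^sup>2\<close> and the same with \<open>F\<close>, applied to a
  sequence with \<open>z\<close> as the shift, have an inner product that contains the mixed products of
  \<open>X = (z + r) \<xi>\<close> and \<open>Y = (z - r) \<xi>\<close>. This form collects the part of it that telescopes with
  factor \<open>r\<^sup>2\<close>. Of the product of \<open>(z + r)\<^sup>2 \<xi>\<close> and \<open>(z - r)\<^sup>2 \<xi>\<close>, the share with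
  coefficient twice the minimum of \<open>E0 * F2\<close> and \<open>E2 * F0\<close> is left out: the squares of these two
  vectors dominate it, and without it the mixed coefficient drops from the sum of the two numbers
  to their absolute difference, which is small enough for a positive definite form.
\<close>

definition "storage E2 E1 E0 F2 F1 F0 X Y =
  (E1 * F0 + E0 * F1) * (norm X)\<^sup>2 + (E1 * F2 + E2 * F1) * (norm Y)\<^sup>2
   + 2 * \<bar>E0 * F2 - E2 * F0\<bar> * inner X (Y :: 'a::real_inner)" for E2 E1 E0 F2 F1 F0 :: real

text \<open>
  A discrete Kalman-Yakubovich-Popov inequality with an explicit solution. The products
  \<open>inner m0 m1\<close>, \<open>inner m1 m2\<close> and \<open>inner m0 m2 + inner m1 m1\<close> are exact differences (with factor
  \<open>r\<^sup>2\<close>) of \<open>(norm X)\<^sup>2\<close>, \<open>(norm Y)\<^sup>2\<close> and \<open>2 * inner X Y\<close>. The rest is a sum of a form in \<open>m0\<close>, \<open>m2\<close>,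
  nonnegative because \<open>k\<^sup>2 \<le> E0 * F2 * E2 * F0\<close> for the minimum \<open>k\<close>, and of a multiple of
  \<open>inner m1 m1\<close>, nonnegative by the two domination hypotheses.
\<close>

lemma storage_dissipation:
  fixes \<xi>0 \<xi>1 \<xi>2 :: "'a::real_inner" and r :: real
  assumes pos: "E2 \<ge> 0" "E0 \<ge> 0" "F2 \<ge> 0" "F0 \<ge> 0"
    and dom: "E0 * F2 \<le> E1 * F1" "E2 * F0 \<le> E1 * F1"
  defines "X \<equiv> \<xi>1 + r *\<^sub>R \<xi>0" and "Y \<equiv> \<xi>1 - r *\<^sub>R \<xi>0"
  defines "X' \<equiv> \<xi>2 + r *\<^sub>R \<xi>1" and "Y' \<equiv> \<xi>2 - r *\<^sub>R \<xi>1"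
  defines "m0 \<equiv> X' + r *\<^sub>R X" and "m1 \<equiv> X' - r *\<^sub>R X" and "m2 \<equiv> Y' - r *\<^sub>R Y"
  shows "storage E2 E1 E0 F2 F1 F0 X' Y' - r\<^sup>2 * storage E2 E1 E0 F2 F1 F0 X Y
     \<le> inner (E2 *\<^sub>R m2 + E1 *\<^sub>R m1 + E0 *\<^sub>R m0) (F2 *\<^sub>R m2 + F1 *\<^sub>R m1 + F0 *\<^sub>R m0)"
proof -
  define k where "k = min (E0 * F2) (E2 * F0)"
  define d where "d = \<bar>E0 * F2 - E2 * F0\<bar>"
  have d: "d = E0 * F2 + E2 * F0 - 2 * k" by (auto simp: d_def k_def min_def)
  have m1': "m1 = Y' + r *\<^sub>R Y" by (simp add: m1_def X'_def X_def Y'_def Y_def algebra_simps)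
  have k0: "k \<ge> 0" using pos by (simp add: k_def)
  have dle: "d \<le> E1 * F1" using dom mult_nonneg_nonneg[OF pos(2,3)] mult_nonneg_nonneg[OF pos(1,4)] by (auto simp: d_def)
  have k2: "k * k \<le> (E2 * F2) * (E0 * F0)"
  proof -
    have "k * k \<le> (E0 * F2) * (E2 * F0)" using pos k0 by (intro mult_mono) (auto simp: k_def)
    then show ?thesis by (simp add: mult_ac)
  qed
  have s01: "inner m0 m1 = (norm X')\<^sup>2 - r\<^sup>2 * (norm X)\<^sup>2"
    unfolding power2_norm_eq_inner
    by (simp add: m0_def m1_def inner_simps algebra_simps inner_commute power2_eq_square)
  have s12: "inner m1 m2 = (norm Y')\<^sup>2 - r\<^sup>2 * (norm Y)\<^sup>2"
    unfolding power2_norm_eq_inner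
    by (simp add: m1' m2_def inner_simps algebra_simps inner_commute power2_eq_square)
  have s02: "inner m0 m2 + inner m1 m1 = 2 * inner X' Y' - r\<^sup>2 * (2 * inner X Y)"
  proof -
    have "inner m1 m1 = inner (X' - r *\<^sub>R X) (Y' + r *\<^sub>R Y)" using m1' by (simp add: m1_def)
    then show ?thesis
      by (simp add: m0_def m2_def inner_simps algebra_simps inner_commute power2_eq_square)
  qed
  have "storage E2 E1 E0 F2 F1 F0 X' Y' - r\<^sup>2 * storage E2 E1 E0 F2 F1 F0 X Y
     = (E1 * F0 + E0 * F1) * inner m0 m1 + (E1 * F2 + E2 * F1) * inner m1 m2 + d * (inner m0 m2 + inner m1 m1)"
    unfolding s01 s12 s02 storage_def d_def by (simp add: algebra_simps)
  moreover have "inner (E2 *\<^sub>R m2 + E1 *\<^sub>R m1 + E0 *\<^sub>R m0) (F2 *\<^sub>R m2 + F1 *\<^sub>R m1 + F0 *\<^sub>R m0)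
    = (E1 * F0 + E0 * F1) * inner m0 m1 + (E1 * F2 + E2 * F1) * inner m1 m2
      + (E0 * F2 + E2 * F0) * inner m0 m2 + E2 * F2 * inner m2 m2 + E1 * F1 * inner m1 m1 + E0 * F0 * inner m0 m0"
    by (simp add: inner_simps algebra_simps inner_commute)
  moreover have "E2 * F2 * inner m2 m2 + E0 * F0 * inner m0 m0 + 2 * k * inner m0 m2 \<ge> 0"
  proof -
    define p where "p = sqrt (E2 * F2)"
    define q where "q = sqrt (E0 * F0)"
    have pq: "p * p = E2 * F2" "q * q = E0 * F0" "p \<ge> 0" "q \<ge> 0" using pos by (auto simp: p_def q_def)
    have "k \<le> p * q"
    proof (rule power2_le_imp_le)
      have "k * k \<le> (p * p) * (q * q)" using k2 pq by simp
      then show "k\<^sup>2 \<le> (p * q)\<^sup>2" by (simp add: power2_eq_square mult_ac)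
    qed (use pq in auto)
    have "\<bar>inner m0 m2\<bar> \<le> norm m0 * norm m2" by (rule Cauchy_Schwarz_ineq2)
    then have "- inner m0 m2 \<le> norm m0 * norm m2" by linarith
    then have "k * - inner m0 m2 \<le> k * (norm m0 * norm m2)" using k0 by (rule mult_left_mono)
    also have "\<dots> \<le> (p * q) * (norm m0 * norm m2)" using \<open>k \<le> p * q\<close> by (intro mult_right_mono) auto
    finally have 1: "k * - inner m0 m2 \<le> (p * q) * (norm m0 * norm m2)" .
    have "0 \<le> (p * norm m2 - q * norm m0)\<^sup>2" by simp
    then have "2 * ((p * q) * (norm m0 * norm m2)) \<le> (p * p) * (norm m2)\<^sup>2 + (q * q) * (norm m0)\<^sup>2"
      by (simp add: power2_eq_square algebra_simps)
    with 1 show ?thesis unfolding pq power2_norm_eq_inner by simp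
  qed
  moreover have "d * inner m1 m1 \<le> E1 * F1 * inner m1 m1" using dle by (intro mult_right_mono) auto
  ultimately show ?thesis unfolding d by (simp add: algebra_simps)
qed

section \<open>Geometric decay of a single mode\<close>

text \<open>
  One mode of the algorithm for an eigenvalue \<open>\<nu> \<noteq> 1\<close>: \<open>x\<close> is the error, \<open>u\<close> the gradient difference
  and \<open>s\<close> the tracking variable minus \<open>u\<close>, which keeps future gradients out of the recurrence. The
  hypothesis \<open>small\<close> says that \<open>(z - \<nu>)\<^sup>2 + \<alpha> * L * (z - 1)\<close> is positive at \<open>z = - r\<close> in the worst
  case \<open>\<nu> = - \<sigma>\<close>. It makes the outer coefficients of the expansion in
  \<open>(z - r)\<^sup>2\<close>, \<open>z\<^sup>2 - r\<^sup>2\<close>, \<open>(z + r)\<^sup>2\<close> positive; they are at most \<open>(r + \<nu>)\<^sup>2\<close> and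
  \<open>(r - \<nu>)\<^sup>2\<close>, whose product is the square of \<open>r\<^sup>2 - \<nu>\<^sup>2\<close>, so that the middle coefficients dominate.
\<close>

lemma disagreement_mode_lyapunov:
  fixes x s u :: "nat \<Rightarrow> 'a::real_inner"
  assumes pos: "0 < \<alpha>" "0 < \<mu>" "\<mu> \<le> L"
    and r: "\<sigma> < r" "r \<le> 1" and lam: "\<bar>\<nu>\<bar> \<le> \<sigma>"
    and small: "\<alpha> * L * (1 + r) < (r - \<sigma>)\<^sup>2"
    and x: "\<And>k. x (Suc k) = \<nu> *\<^sub>R x k - \<alpha> *\<^sub>R s k - \<alpha> *\<^sub>R u k"
    and s: "\<And>k. s (Suc k) = \<nu> *\<^sub>R s k + (\<nu> - 1) *\<^sub>R u k"
  shows "\<exists>V K. 0 < K \<and> (\<forall>k. (norm (x k))\<^sup>2 \<le> K * V k \<and>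
            V (Suc k) - r\<^sup>2 * V k \<le> inner (u k - \<mu> *\<^sub>R x k) (u k - L *\<^sub>R x k))"
proof -
  define a b where "a = \<alpha> * \<mu>" and "b = \<alpha> * L"
  have r0: "r > 0" and lr: "\<bar>\<nu>\<bar> < r" using r lam by linarith+
  have ab: "0 < a" "a \<le> b" using pos by (auto simp: a_def b_def)
  \<comment> \<open>Multiplied by \<open>4 * r\<^sup>2\<close>, the polynomial \<open>(z - \<nu>)\<^sup>2 + h * (z - 1)\<close> is the combination of
    \<open>(z - r)\<^sup>2\<close>, \<open>z\<^sup>2 - r\<^sup>2\<close>, \<open>(z + r)\<^sup>2\<close> with coefficients \<open>E2\<close>, \<open>E1\<close>, \<open>E0\<close> for \<open>h = a\<close> and \<open>F2\<close>, \<open>F1\<close>, \<open>F0\<close> for \<open>h = b\<close>.\<close>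
  define E0 E1 E2 where "E0 = (r - \<nu>)\<^sup>2 - a * (1 - r)" and "E1 = 2 * (r\<^sup>2 - \<nu>\<^sup>2 + a)"
    and "E2 = (r + \<nu>)\<^sup>2 - a * (1 + r)"
  define F0 F1 F2 where "F0 = (r - \<nu>)\<^sup>2 - b * (1 - r)" and "F1 = 2 * (r\<^sup>2 - \<nu>\<^sup>2 + b)"
    and "F2 = (r + \<nu>)\<^sup>2 - b * (1 + r)"
  have sq: "(r - \<sigma>)\<^sup>2 \<le> (r - \<nu>)\<^sup>2" "(r - \<sigma>)\<^sup>2 \<le> (r + \<nu>)\<^sup>2"
    using r lam by (intro power_mono; linarith)+
  have h: "0 < (r - \<nu>)\<^sup>2 - h * (1 - r)" "(r - \<nu>)\<^sup>2 - h * (1 - r) \<le> (r - \<nu>)\<^sup>2"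
     "0 < (r + \<nu>)\<^sup>2 - h * (1 + r)" "(r + \<nu>)\<^sup>2 - h * (1 + r) \<le> (r + \<nu>)\<^sup>2"
    if "0 < h" "h \<le> b" for h
  proof -
    have "h * (1 + r) \<le> b * (1 + r)" using that r0 by (intro mult_right_mono) auto
    moreover have "h * (1 - r) \<le> h * (1 + r)" using that r0 by (intro mult_left_mono) auto
    moreover have "0 \<le> h * (1 - r)" "0 \<le> h * (1 + r)" using that r r0 by auto
    ultimately show "0 < (r - \<nu>)\<^sup>2 - h * (1 - r)" "(r - \<nu>)\<^sup>2 - h * (1 - r) \<le> (r - \<nu>)\<^sup>2"
     "0 < (r + \<nu>)\<^sup>2 - h * (1 + r)" "(r + \<nu>)\<^sup>2 - h * (1 + r) \<le> (r + \<nu>)\<^sup>2"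
      using sq small unfolding b_def by linarith+
  qed
  have E: "0 < E0" "E0 \<le> (r - \<nu>)\<^sup>2" "0 < E2" "E2 \<le> (r + \<nu>)\<^sup>2"
    and F: "0 < F0" "F0 \<le> (r - \<nu>)\<^sup>2" "0 < F2" "F2 \<le> (r + \<nu>)\<^sup>2"
    using h[of a] h[of b] ab unfolding E0_def E2_def F0_def F2_def by auto
  define w where "w = r\<^sup>2 - \<nu>\<^sup>2"
  have w: "w > 0" using lr power_strict_mono[of "\<bar>\<nu>\<bar>" r 2] by (simp add: w_def)
  have EF1: "E1 \<ge> w" "F1 \<ge> w" using w ab unfolding E1_def F1_def w_def by auto
  have ww: "w * w \<le> E1 * F1" using EF1 w by (intro mult_mono) auto
  have wfac: "(r - \<nu>)\<^sup>2 * (r + \<nu>)\<^sup>2 = w * w" "(r + \<nu>)\<^sup>2 * (r - \<nu>)\<^sup>2 = w * w"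
    unfolding w_def by (simp_all add: power2_eq_square algebra_simps)
  have dom: "E0 * F2 \<le> E1 * F1" "E2 * F0 \<le> E1 * F1"
    using mult_mono[OF E(2) F(4)] mult_mono[OF E(4) F(2)] ww E F unfolding wfac by auto
  define p q d where "p = E1 * F0 + E0 * F1" and "q = E1 * F2 + E2 * F1"
    and "d = \<bar>E0 * F2 - E2 * F0\<bar>"
  have EF1p: "0 < E1" "0 < F1" using EF1 w by auto
  have p: "p > 0" and q: "q > 0" using E F EF1p by (auto simp: p_def q_def add_pos_pos)
  have pq: "p * q - d\<^sup>2 > 0"
  proof -
    have EF: "E0 * F2 > 0" "E2 * F0 > 0" using E F by auto
    have "d * d \<le> (E0 * F2 + E2 * F0) * (E1 * F1)"
      using dom EF unfolding d_def by (intro mult_mono) auto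
    moreover have "p * q = (E0 * F2 + E2 * F0) * (E1 * F1) + (E1 * E1 * (F0 * F2) + F1 * F1 * (E0 * E2))"
      unfolding p_def q_def by Groebner_Basis.algebra
    moreover have "E1 * E1 * (F0 * F2) + F1 * F1 * (E0 * E2) > 0"
      using E F EF1p by (intro add_pos_pos mult_pos_pos) auto
    ultimately show ?thesis unfolding power2_eq_square by linarith
  qed
  define \<beta> \<kappa> where "\<beta> = 1 / \<alpha>" and "\<kappa> = 1 / (1 - \<nu>)"
  have \<beta>: "\<alpha> * \<beta> = 1" using pos by (simp add: \<beta>_def)
  have \<kappa>: "(1 - \<nu>) * \<kappa> = 1" using lr r by (simp add: \<kappa>_def)
  \<comment> \<open>The transfer function from \<open>u\<close> to \<open>x\<close> is \<open>- \<alpha> * (z - 1) / (z - \<nu>)\<^sup>2\<close>; \<open>\<xi>\<close> is the signal with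
    \<open>u = (z - \<nu>)\<^sup>2 \<xi>\<close> and \<open>x = - \<alpha> * (z - 1) \<xi>\<close>, expressed through the current state.\<close>
  define \<xi> where "\<xi> k = (\<beta> * \<kappa>) *\<^sub>R x k - (\<kappa> * \<kappa>) *\<^sub>R s k" for k
  have \<xi>_Suc: "\<xi> (Suc k) = \<xi> k - \<beta> *\<^sub>R x k" for k
  proof (rule vector_eq_ldot[THEN iffD1], rule allI)
    fix z
    show "inner z (\<xi> (Suc k)) = inner z (\<xi> k - \<beta> *\<^sub>R x k)"
      unfolding \<xi>_def x s inner_diff_right inner_add_right inner_scaleR_right using \<beta> \<kappa> by Groebner_Basis.algebra
  qed
  have x_\<xi>: "x k = \<alpha> *\<^sub>R (\<xi> k - \<xi> (Suc k))" for k
    unfolding \<xi>_Suc using \<beta> by simp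
  have s_\<xi>: "s k = (1 - \<nu>) *\<^sub>R (\<nu> *\<^sub>R \<xi> k - \<xi> (Suc k))" for k
  proof (rule vector_eq_ldot[THEN iffD1], rule allI)
    fix z
    show "inner z (s k) = inner z ((1 - \<nu>) *\<^sub>R (\<nu> *\<^sub>R \<xi> k - \<xi> (Suc k)))"
      unfolding \<xi>_Suc unfolding \<xi>_def inner_diff_right inner_add_right inner_scaleR_right using \<beta> \<kappa> by Groebner_Basis.algebra
  qed
  have u_\<xi>: "u k = \<xi> (Suc (Suc k)) - (2 * \<nu>) *\<^sub>R \<xi> (Suc k) + \<nu>\<^sup>2 *\<^sub>R \<xi> k" for k
  proof (rule vector_eq_ldot[THEN iffD1], rule allI)
    fix z
    have "inner z (x (Suc k)) = inner z (\<nu> *\<^sub>R x k - \<alpha> *\<^sub>R s k - \<alpha> *\<^sub>R u k)" by (simp add: x)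
    then have "\<alpha> * inner z (u k) = \<alpha> * inner z (\<xi> (Suc (Suc k)) - (2 * \<nu>) *\<^sub>R \<xi> (Suc k) + \<nu>\<^sup>2 *\<^sub>R \<xi> k)"
      unfolding x_\<xi> s_\<xi> inner_diff_right inner_add_right inner_scaleR_right by Groebner_Basis.algebra
    then show "inner z (u k) = inner z (\<xi> (Suc (Suc k)) - (2 * \<nu>) *\<^sub>R \<xi> (Suc k) + \<nu>\<^sup>2 *\<^sub>R \<xi> k)"
      using pos by simp
  qed
  define X Y where "X k = \<xi> (Suc k) + r *\<^sub>R \<xi> k" and "Y k = \<xi> (Suc k) - r *\<^sub>R \<xi> k" for k
  define S where "S k = storage E2 E1 E0 F2 F1 F0 (X k) (Y k)" for k
  have S: "S k = p * (norm (X k))\<^sup>2 + q * (norm (Y k))\<^sup>2 + 2 * d * inner (X k) (Y k)" for k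
    by (simp add: S_def storage_def p_def q_def d_def)
  have fac: "(4 * r\<^sup>2) *\<^sub>R (u k - h *\<^sub>R x k) =
       ((r + \<nu>)\<^sup>2 - \<alpha> * h * (1 + r)) *\<^sub>R (Y (Suc k) - r *\<^sub>R Y k)
       + (2 * (r\<^sup>2 - \<nu>\<^sup>2 + \<alpha> * h)) *\<^sub>R (X (Suc k) - r *\<^sub>R X k)
       + ((r - \<nu>)\<^sup>2 - \<alpha> * h * (1 - r)) *\<^sub>R (X (Suc k) + r *\<^sub>R X k)" for h k
  proof (rule vector_eq_ldot[THEN iffD1], rule allI, goal_cases)
    case (1 z)
    show ?case
      unfolding x_\<xi> u_\<xi> X_def Y_def inner_diff_right inner_add_right inner_scaleR_right by Groebner_Basis.algebra
  qed
  have step: "S (Suc k) - r\<^sup>2 * S k \<le> (4 * r\<^sup>2)\<^sup>2 * inner (u k - \<mu> *\<^sub>R x k) (u k - L *\<^sub>R x k)" for k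
  proof -
    have "S (Suc k) - r\<^sup>2 * S k \<le> inner ((4 * r\<^sup>2) *\<^sub>R (u k - \<mu> *\<^sub>R x k)) ((4 * r\<^sup>2) *\<^sub>R (u k - L *\<^sub>R x k))"
      unfolding fac S_def X_def Y_def E0_def[symmetric] E1_def[symmetric] E2_def[symmetric]
        F0_def[symmetric] F1_def[symmetric] F2_def[symmetric] a_def[symmetric] b_def[symmetric]
      using E F dom by (intro storage_dissipation) auto
    then show ?thesis by (simp add: power2_eq_square)
  qed
  define D where "D = p * q - d\<^sup>2"
  have D: "D > 0" using pq by (simp add: D_def)
  have Yb: "D * (norm (Y k))\<^sup>2 \<le> p * S k" for k
    using definite_quadratic_form[of p q d "Y k" "X k"] by (simp add: S D_def)
  have Xb: "D * (norm (X k))\<^sup>2 \<le> q * S k" for k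
    using definite_quadratic_form[of q p d "X k" "Y k"] by (simp add: S D_def inner_commute algebra_simps)
  have x_XY: "x k = (\<alpha> / (2 * r)) *\<^sub>R ((1 - r) *\<^sub>R X k - (1 + r) *\<^sub>R Y k)" for k
  proof (rule vector_eq_ldot[THEN iffD1], rule allI, goal_cases)
    case (1 z)
    show ?case
      unfolding x_\<xi> X_def Y_def inner_diff_right inner_add_right inner_scaleR_right using r0
      by (simp add: field_simps)
  qed
  have xb: "D * (norm (x k))\<^sup>2 \<le> (\<alpha> / (2 * r))\<^sup>2 * (8 * (p + q)) * S k" for k
  proof -
    have "norm ((1 - r) *\<^sub>R X k - (1 + r) *\<^sub>R Y k) \<le> (1 - r) * norm (X k) + (1 + r) * norm (Y k)"
      using norm_triangle_ineq4[of "(1 - r) *\<^sub>R X k" "(1 + r) *\<^sub>R Y k"] r r0 by simp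
    also have "\<dots> \<le> 2 * norm (X k) + 2 * norm (Y k)"
      using r r0 by (intro add_mono mult_right_mono) auto
    finally have "(norm ((1 - r) *\<^sub>R X k - (1 + r) *\<^sub>R Y k))\<^sup>2 \<le> (2 * norm (X k) + 2 * norm (Y k))\<^sup>2"
      by (intro power_mono) auto
    also have "\<dots> \<le> 8 * (norm (X k))\<^sup>2 + 8 * (norm (Y k))\<^sup>2"
      using zero_le_power2[of "norm (X k) - norm (Y k)"] by (simp add: power2_eq_square algebra_simps)
    finally have "D * (norm ((1 - r) *\<^sub>R X k - (1 + r) *\<^sub>R Y k))\<^sup>2 \<le> D * (8 * (norm (X k))\<^sup>2 + 8 * (norm (Y k))\<^sup>2)"
      using D by (intro mult_left_mono) auto
    also have "\<dots> \<le> 8 * (p + q) * S k" using Xb[of k] Yb[of k] by (simp add: algebra_simps)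
    finally have "(\<alpha> / (2 * r))\<^sup>2 * (D * (norm ((1 - r) *\<^sub>R X k - (1 + r) *\<^sub>R Y k))\<^sup>2) \<le> (\<alpha> / (2 * r))\<^sup>2 * (8 * (p + q) * S k)"
      by (intro mult_left_mono) auto
    moreover have "(norm (x k))\<^sup>2 = (\<alpha> / (2 * r))\<^sup>2 * (norm ((1 - r) *\<^sub>R X k - (1 + r) *\<^sub>R Y k))\<^sup>2"
      by (subst x_XY) (simp add: power_mult_distrib power_divide)
    ultimately show ?thesis by (simp add: mult_ac)
  qed
  define K where "K = (\<alpha> / (2 * r))\<^sup>2 * (8 * (p + q)) * (4 * r\<^sup>2)\<^sup>2 / D"
  define V where "V k = S k / (4 * r\<^sup>2)\<^sup>2" for k
  have "0 < K" using p q D r0 pos by (simp add: K_def)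
  moreover have "(norm (x k))\<^sup>2 \<le> K * V k" for k
  proof -
    have "K * V k = (\<alpha> / (2 * r))\<^sup>2 * (8 * (p + q)) * S k / D" using r0 by (simp add: K_def V_def)
    then show ?thesis using xb[of k] D by (simp add: pos_le_divide_eq mult_ac)
  qed
  moreover have "V (Suc k) - r\<^sup>2 * V k \<le> inner (u k - \<mu> *\<^sub>R x k) (u k - L *\<^sub>R x k)" for k
  proof -
    have c: "(4 * r\<^sup>2)\<^sup>2 > 0" using r0 by simp
    have "V (Suc k) - r\<^sup>2 * V k = (S (Suc k) - r\<^sup>2 * S k) / (4 * r\<^sup>2)\<^sup>2"
      by (simp add: V_def diff_divide_distrib)
    also have "\<dots> \<le> inner (u k - \<mu> *\<^sub>R x k) (u k - L *\<^sub>R x k)"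
      using step[of k] c by (simp only: pos_divide_le_eq[OF c] mult.commute)
    finally show ?thesis .
  qed
  ultimately show ?thesis by blast
qed

text \<open>
  The average of the tracking variables equals the average of the gradients, so this mode is
  plain gradient descent. Here \<open>u - h *\<^sub>R x\<close> is a combination of \<open>x (Suc k) - r *\<^sub>R x k\<close> and
  \<open>x (Suc k) + r *\<^sub>R x k\<close>, with coefficients that are positive up to a common factor because
  \<open>\<alpha> * h\<close> lies strictly between \<open>1 - r\<close> and \<open>1 + r\<close>. The product of the two vectors telescopes and
  their squares are nonnegative.
\<close>

lemma consensus_mode_lyapunov:
  fixes x u :: "nat \<Rightarrow> 'a::real_inner"
  assumes pos: "0 < \<alpha>" "0 < r" and e: "1 - r < \<alpha> * \<mu>" "\<mu> \<le> L" "\<alpha> * L < 1 + r"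
    and x: "\<And>k. x (Suc k) = x k - \<alpha> *\<^sub>R u k"
  shows "\<exists>V K. 0 < K \<and> (\<forall>k. (norm (x k))\<^sup>2 \<le> K * V k \<and>
            V (Suc k) - r\<^sup>2 * V k \<le> inner (u k - \<mu> *\<^sub>R x k) (u k - L *\<^sub>R x k))"
proof -
  define a b where "a = \<alpha> * \<mu>" and "b = \<alpha> * L"
  have ab: "1 - r < a" "a \<le> b" "b < 1 + r" using e pos by (auto simp: a_def b_def)
  define e0 e1 f0 f1 where "e0 = r - 1 + a" and "e1 = r + 1 - a" and "f0 = r - 1 + b" and "f1 = r + 1 - b"
  have ef: "e0 > 0" "e1 > 0" "f0 > 0" "f1 > 0" using ab by (auto simp: e0_def e1_def f0_def f1_def)
  define c where "c = (e1 * f0 + e0 * f1) / (2 * r * \<alpha>)\<^sup>2"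
  have c: "c > 0" using ef pos by (auto simp: c_def intro!: divide_pos_pos add_pos_pos)
  have "c * (norm (x (Suc k)))\<^sup>2 - r\<^sup>2 * (c * (norm (x k))\<^sup>2) \<le> inner (u k - \<mu> *\<^sub>R x k) (u k - L *\<^sub>R x k)" for k
  proof -
    define X Y where "X = x (Suc k) + r *\<^sub>R x k" and "Y = x (Suc k) - r *\<^sub>R x k"
    have fac: "(- (2 * r * \<alpha>)) *\<^sub>R (u k - h *\<^sub>R x k) = (r + 1 - \<alpha> * h) *\<^sub>R Y + (r - 1 + \<alpha> * h) *\<^sub>R X" for h
    proof (rule vector_eq_ldot[THEN iffD1], rule allI, goal_cases)
      case (1 z)
      show ?case unfolding X_def Y_def x inner_diff_right inner_add_right inner_scaleR_right by Groebner_Basis.algebra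
    qed
    have XY: "inner X Y = (norm (x (Suc k)))\<^sup>2 - r\<^sup>2 * (norm (x k))\<^sup>2" "inner Y X = inner X Y"
      unfolding X_def Y_def power2_norm_eq_inner
      by (simp_all add: inner_diff_left inner_diff_right inner_add_left inner_add_right inner_commute algebra_simps power2_eq_square)
    have "(2 * r * \<alpha>)\<^sup>2 * inner (u k - \<mu> *\<^sub>R x k) (u k - L *\<^sub>R x k)
       = inner ((- (2 * r * \<alpha>)) *\<^sub>R (u k - \<mu> *\<^sub>R x k)) ((- (2 * r * \<alpha>)) *\<^sub>R (u k - L *\<^sub>R x k))"
      by (simp add: power2_eq_square)
    also have "\<dots> = inner (e1 *\<^sub>R Y + e0 *\<^sub>R X) (f1 *\<^sub>R Y + f0 *\<^sub>R X)"
      unfolding fac e0_def e1_def f0_def f1_def a_def b_def ..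
    also have "\<dots> = e1 * f1 * inner Y Y + e0 * f0 * inner X X + (e1 * f0 + e0 * f1) * inner X Y"
      by (simp add: inner_add_left inner_add_right XY(2) algebra_simps)
    also have "\<dots> \<ge> (e1 * f0 + e0 * f1) * inner X Y" using ef by simp
    finally have "(e1 * f0 + e0 * f1) * inner X Y / (2 * r * \<alpha>)\<^sup>2 \<le> inner (u k - \<mu> *\<^sub>R x k) (u k - L *\<^sub>R x k)"
      using pos by (simp add: pos_divide_le_eq mult_ac)
    moreover have "(e1 * f0 + e0 * f1) * inner X Y / (2 * r * \<alpha>)\<^sup>2
        = c * (norm (x (Suc k)))\<^sup>2 - r\<^sup>2 * (c * (norm (x k))\<^sup>2)"
      unfolding XY c_def by (simp add: right_diff_distrib diff_divide_distrib mult_ac)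
    ultimately show ?thesis by simp
  qed
  moreover have "(norm (x k))\<^sup>2 \<le> (1 / c) * (c * (norm (x k))\<^sup>2)" for k using c by simp
  ultimately show ?thesis using c by (intro exI[of _ "\<lambda>k. c * (norm (x k))\<^sup>2"] exI[of _ "1 / c"]) simp
qed

section \<open>Orthonormal eigenbases of real symmetric matrices\<close>

text \<open>
  Vectors are functions on the natural numbers of which only the entries below \<open>N\<close> count, so
  that the dimension \<open>N\<close> can be a variable.
\<close>

definition orthonormal :: "nat \<Rightarrow> nat \<Rightarrow> (nat \<Rightarrow> nat \<Rightarrow> real) \<Rightarrow> bool" where
  "orthonormal N m v \<longleftrightarrow> (\<forall>j<m. \<forall>k<m. (\<Sum>i<N. v j i * v k i) = of_bool (j = k))"

lemma residual_orthogonal: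
  assumes v: "orthonormal N m v" and "l < N" "j < m"
  shows "(\<Sum>i<N. v j i * (of_bool (i = l) - (\<Sum>k<m. v k l * v k i))) = 0"
proof -
  have "(\<Sum>i<N. v j i * (\<Sum>k<m. v k l * v k i)) = (\<Sum>k<m. v k l * (\<Sum>i<N. v j i * v k i))"
    unfolding sum_distrib_left by (subst sum.swap) (simp add: mult_ac)
  also have "\<dots> = (\<Sum>k<m. v k l * of_bool (j = k))"
    using v \<open>j < m\<close> by (intro sum.cong) (auto simp: orthonormal_def)
  also have "\<dots> = v j l" using \<open>j < m\<close> by (simp add: of_bool_def if_distrib cong: if_cong)
  finally have "(\<Sum>i<N. v j i * (\<Sum>k<m. v k l * v k i)) = v j l" .
  moreover have "(\<Sum>i<N. v j i * of_bool (i = l)) = v j l"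
    using \<open>l < N\<close> by (simp add: of_bool_def if_distrib cong: if_cong)
  ultimately show ?thesis by (simp only: right_diff_distrib sum_subtractf)
qed

lemma residual_norm:
  assumes v: "orthonormal N m v" and l: "l < N"
  shows "(\<Sum>i<N. (of_bool (i = l) - (\<Sum>k<m. v k l * v k i))\<^sup>2) = 1 - (\<Sum>k<m. (v k l)\<^sup>2)"
proof -
  define e where "e i = of_bool (i = l) - (\<Sum>k<m. v k l * v k i)" for i
  have "(\<Sum>i<N. (\<Sum>k<m. v k l * v k i) * e i) = (\<Sum>k<m. v k l * (\<Sum>i<N. v k i * e i))"
    unfolding sum_distrib_left sum_distrib_right by (subst sum.swap) (simp add: mult_ac)
  also have "\<dots> = 0" using residual_orthogonal[OF v l] by (simp add: e_def)
  finally have z: "(\<Sum>i<N. (\<Sum>k<m. v k l * v k i) * e i) = 0" .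
  have "(\<Sum>i<N. (e i)\<^sup>2) = (\<Sum>i<N. of_bool (i = l) * e i) - (\<Sum>i<N. (\<Sum>k<m. v k l * v k i) * e i)"
    by (simp add: e_def power2_eq_square left_diff_distrib sum_subtractf)
  also have "\<dots> = e l" using l by (simp add: z of_bool_def if_distrib if_distribR cong: if_cong)
  finally show ?thesis by (simp add: e_def power2_eq_square)
qed

text \<open>
  The residuals are those of the standard unit vectors after projection to the span of the
  system. Their total squared norm counts the missing dimensions, which gives both the
  existence of a further orthogonal vector (\<open>m < N\<close>) and completeness (\<open>m = N\<close>) without any
  dimension theory.
\<close>

lemma residual_norm_total:
  assumes "orthonormal N m v"
  shows "(\<Sum>l<N. 1 - (\<Sum>k<m. (v k l)\<^sup>2)) = real N - real m"
proof -
  have "(\<Sum>l<N. \<Sum>k<m. (v k l)\<^sup>2) = (\<Sum>k<m. \<Sum>l<N. v k l * v k l)"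
    by (subst sum.swap) (simp add: power2_eq_square)
  also have "\<dots> = (\<Sum>k<m. 1)" using assms by (intro sum.cong) (auto simp: orthonormal_def)
  finally show ?thesis by (simp add: sum_subtractf)
qed

lemma exists_unit_orthogonal:
  assumes v: "orthonormal N m v" and "m < N"
  shows "\<exists>w. (\<forall>i\<ge>N. w i = 0) \<and> (\<Sum>i<N. (w i)\<^sup>2) = 1 \<and> (\<forall>j<m. (\<Sum>i<N. v j i * w i) = 0)"
proof -
  have "\<exists>l<N. 1 - (\<Sum>k<m. (v k l)\<^sup>2) > 0"
  proof (rule ccontr)
    assume "\<not> ?thesis"
    then have "(\<Sum>l<N. 1 - (\<Sum>k<m. (v k l)\<^sup>2)) \<le> 0" by (intro sum_nonpos) (meson lessThan_iff not_le)
    then show False using residual_norm_total[OF v] \<open>m < N\<close> by simp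
  qed
  then obtain l where l: "l < N" and pos: "1 - (\<Sum>k<m. (v k l)\<^sup>2) > 0" by blast
  define e where "e i = of_bool (i = l) - (\<Sum>k<m. v k l * v k i)" for i
  define c where "c = (\<Sum>i<N. (e i)\<^sup>2)"
  have c: "c > 0" using pos residual_norm[OF v l] by (simp add: c_def e_def)
  define w where "w i = (if i < N then e i / sqrt c else 0)" for i
  have "(\<Sum>i<N. (w i)\<^sup>2) = 1"
    using c by (simp add: w_def power_divide flip: sum_divide_distrib c_def)
  moreover have "(\<Sum>i<N. v j i * w i) = 0" if "j < m" for j
    using residual_orthogonal[OF v l that]
    by (simp add: w_def e_def[symmetric] flip: sum_divide_distrib)
  ultimately show ?thesis by (intro exI[of _ w]) (simp add: w_def)
qed

lemma orthonormal_complete: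
  assumes v: "orthonormal N N v" and "l < N" "i < N"
  shows "(\<Sum>k<N. v k l * v k i) = of_bool (i = l)"
proof -
  define e where "e l i = of_bool (i = l) - (\<Sum>k<N. v k l * v k i)" for l i
  have "(\<Sum>l<N. \<Sum>i<N. (e l i)\<^sup>2) = (\<Sum>l<N. 1 - (\<Sum>k<N. (v k l)\<^sup>2))"
    by (intro sum.cong) (auto simp: e_def residual_norm[OF v])
  then have "(\<Sum>l<N. \<Sum>i<N. (e l i)\<^sup>2) = 0" using residual_norm_total[OF v] by simp
  then have "(\<Sum>i<N. (e l i)\<^sup>2) = 0"
    using \<open>l < N\<close> by (simp add: sum_nonneg_eq_0_iff sum_nonneg)
  then have "(e l i)\<^sup>2 = 0" using \<open>i < N\<close> by (subst (asm) sum_nonneg_eq_0_iff) auto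
  then show ?thesis by (simp add: e_def)
qed

lemma orthonormal_parseval:
  fixes p q :: "nat \<Rightarrow> 'a::real_inner"
  assumes v: "orthonormal N N v"
  shows "(\<Sum>j<N. inner (\<Sum>i<N. v j i *\<^sub>R p i) (\<Sum>i<N. v j i *\<^sub>R q i)) = (\<Sum>i<N. inner (p i) (q i))"
proof -
  have "(\<Sum>j<N. inner (\<Sum>i<N. v j i *\<^sub>R p i) (\<Sum>i<N. v j i *\<^sub>R q i))
      = (\<Sum>j<N. \<Sum>i<N. \<Sum>l<N. v j i * v j l * inner (p i) (q l))"
    by (simp add: inner_sum_left) (simp add: inner_sum_right sum_distrib_left mult_ac)
  also have "\<dots> = (\<Sum>i<N. \<Sum>j<N. \<Sum>l<N. v j i * v j l * inner (p i) (q l))"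
    by (rule sum.swap)
  also have "\<dots> = (\<Sum>i<N. \<Sum>l<N. (\<Sum>j<N. v j i * v j l) * inner (p i) (q l))"
    unfolding sum_distrib_right by (intro sum.cong refl sum.swap)
  also have "\<dots> = (\<Sum>i<N. \<Sum>l<N. of_bool (l = i) * inner (p i) (q l))"
    using orthonormal_complete[OF v] by (intro sum.cong) auto
  also have "\<dots> = (\<Sum>i<N. inner (p i) (q i))"
    by (simp add: of_bool_def if_distrib if_distribR cong: if_cong)
  finally show ?thesis .
qed

lemma orthonormal_expand:
  fixes p :: "nat \<Rightarrow> 'a::real_vector"
  assumes v: "orthonormal N N v" and "l < N"
  shows "p l = (\<Sum>j<N. v j l *\<^sub>R (\<Sum>i<N. v j i *\<^sub>R p i))"
proof -
  have "(\<Sum>j<N. v j l *\<^sub>R (\<Sum>i<N. v j i *\<^sub>R p i)) = (\<Sum>i<N. (\<Sum>j<N. v j l * v j i) *\<^sub>R p i)"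
    by (simp add: scaleR_sum_right scaleR_sum_left) (rule sum.swap)
  also have "\<dots> = (\<Sum>i<N. of_bool (i = l) *\<^sub>R p i)"
    using orthonormal_complete[OF v \<open>l < N\<close>] by (intro sum.cong) auto
  also have "\<dots> = p l" using \<open>l < N\<close> by (simp add: of_bool_def if_distrib if_distribR cong: if_cong)
  finally show ?thesis ..
qed

text \<open>
  Setting the irrelevant entries to zero makes this a closed subset of a product of compact
  intervals, which is compact by Tychonoff's theorem.
\<close>

lemma compact_unit_sphere_constrained:
  "compact {w :: nat \<Rightarrow> real. (\<forall>i\<ge>N. w i = 0) \<and> (\<Sum>i<N. (w i)\<^sup>2) = 1 \<and> (\<forall>j<m. (\<Sum>i<N. v j i * w i) = 0)}"
    (is "compact ?S")
proof -
  have coord: "continuous_on UNIV (\<lambda>w :: nat \<Rightarrow> real. w i)" for i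
    by (rule continuous_on_product_coordinates)
  have "closed ?S"
    by (intro closed_Collect_conj closed_Collect_all closed_Collect_imp open_Collect_const
         closed_Collect_eq continuous_intros coord)
  moreover have "compact (PiE UNIV (\<lambda>_::nat. {-1..1::real}))"
  proof -
    have "compactin (product_topology (\<lambda>_::nat. euclidean) UNIV) (PiE UNIV (\<lambda>_. {-1..1::real}))"
      by (subst compactin_PiE) auto
    then show ?thesis by (simp add: euclidean_product_topology)
  qed
  ultimately have "compact (PiE UNIV (\<lambda>_::nat. {-1..1::real}) \<inter> ?S)" by (intro compact_Int_closed)
  moreover have "?S \<subseteq> PiE UNIV (\<lambda>_::nat. {-1..1::real})"
  proof (clarsimp simp: PiE_UNIV_domain)
    fix w :: "nat \<Rightarrow> real" and i
    assume z: "\<forall>i\<ge>N. w i = 0" and 1: "(\<Sum>i<N. (w i)\<^sup>2) = 1"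
    have "(w i)\<^sup>2 \<le> 1"
    proof (cases "i < N")
      case True
      then have "(w i)\<^sup>2 \<le> (\<Sum>i<N. (w i)\<^sup>2)" by (intro member_le_sum) auto
      then show ?thesis using 1 by simp
    qed (use z in auto)
    then show "- 1 \<le> w i \<and> w i \<le> 1" using abs_square_le_1[of "w i"] by (simp add: abs_le_iff)
  qed
  ultimately show ?thesis by (simp only: Int_absorb1)
qed

text \<open>
  The Rayleigh quotient attains its maximum \<open>l\<close> over the unit vectors orthogonal to the known
  eigenvectors, at some \<open>w\<close>. The vector \<open>g = A w - l w\<close> is orthogonal to \<open>w\<close> and, by symmetry of \<open>A\<close>,
  to the known eigenvectors. Moving from \<open>w\<close> along \<open>g\<close> would increase the quotient to first order
  by twice the squared norm of \<open>g\<close>, hence \<open>g = 0\<close>.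
\<close>

lemma eigenvector_orthogonal_to_eigenvectors:
  fixes A :: "nat \<Rightarrow> nat \<Rightarrow> real"
  assumes sym: "\<And>i k. i < N \<Longrightarrow> k < N \<Longrightarrow> A i k = A k i"
    and v: "orthonormal N m v" and "m < N"
    and eig: "\<And>j i. j < m \<Longrightarrow> i < N \<Longrightarrow> (\<Sum>k<N. A i k * v j k) = lam j * v j i"
  shows "\<exists>w l. (\<Sum>i<N. (w i)\<^sup>2) = 1 \<and> (\<forall>j<m. (\<Sum>i<N. v j i * w i) = 0) \<and>
            (\<forall>i<N. (\<Sum>k<N. A i k * w k) = l * w i)"
proof -
  define S where "S = {w :: nat \<Rightarrow> real. (\<forall>i\<ge>N. w i = 0) \<and> (\<Sum>i<N. (w i)\<^sup>2) = 1 \<and> (\<forall>j<m. (\<Sum>i<N. v j i * w i) = 0)}"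
  define B where "B p q = (\<Sum>i<N. p i * (\<Sum>k<N. A i k * q k))" for p q
  define Q where "Q p = B p p" for p
  define n where "n p = (\<Sum>i<N. (p i)\<^sup>2)" for p :: "nat \<Rightarrow> real"
  have Bsym: "B p q = B q p" for p q
  proof -
    have "B p q = (\<Sum>i<N. \<Sum>k<N. A i k * (p i * q k))" by (simp add: B_def sum_distrib_left mult_ac)
    also have "\<dots> = (\<Sum>k<N. \<Sum>i<N. A i k * (p i * q k))" by (rule sum.swap)
    also have "\<dots> = (\<Sum>k<N. \<Sum>i<N. A k i * (p i * q k))" using sym by (intro sum.cong) auto
    also have "\<dots> = B q p" by (simp add: B_def sum_distrib_left mult_ac)
    finally show ?thesis .
  qed
  have coord: "continuous_on S (\<lambda>w :: nat \<Rightarrow> real. w i)" for i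
    by (rule continuous_on_subset[OF continuous_on_product_coordinates]) simp
  have contQ: "continuous_on S Q" unfolding Q_def B_def by (intro continuous_intros coord)
  have "S \<noteq> {}" using exists_unit_orthogonal[OF v \<open>m < N\<close>] by (auto simp: S_def)
  moreover have "compact S" unfolding S_def by (rule compact_unit_sphere_constrained)
  ultimately obtain w where wS: "w \<in> S" and max: "\<And>z. z \<in> S \<Longrightarrow> Q z \<le> Q w"
    using continuous_attains_sup[OF _ _ contQ] by blast
  define l where "l = Q w"
  have w1: "n w = 1" and wo: "\<And>j. j < m \<Longrightarrow> (\<Sum>i<N. v j i * w i) = 0" using wS by (auto simp: S_def n_def)
  have bound: "Q z \<le> l * n z" if "\<And>j. j < m \<Longrightarrow> (\<Sum>i<N. v j i * z i) = 0" "n z > 0" for z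
  proof -
    define z' where "z' i = (if i < N then z i / sqrt (n z) else 0)" for i
    have "(\<Sum>i<N. (z' i)\<^sup>2) = 1"
      using that(2) by (simp add: z'_def power_divide flip: sum_divide_distrib n_def)
    moreover have "(\<Sum>i<N. v j i * z' i) = 0" if "j < m" for j
      using \<open>\<And>j. j < m \<Longrightarrow> (\<Sum>i<N. v j i * z i) = 0\<close>[OF that] by (simp add: z'_def flip: sum_divide_distrib)
    ultimately have "z' \<in> S" by (simp add: S_def z'_def)
    then have "Q z' \<le> l" using max by (simp add: l_def)
    moreover have "Q z' = Q z / (sqrt (n z) * sqrt (n z))"
      by (simp add: Q_def B_def z'_def flip: sum_divide_distrib)
    ultimately show ?thesis using that(2) by (simp add: pos_divide_le_eq)
  qed
  define g where "g i = (\<Sum>k<N. A i k * w k) - l * w i" for i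
  have go: "(\<Sum>i<N. v j i * g i) = 0" if "j < m" for j
  proof -
    have "(\<Sum>i<N. v j i * g i) = B (v j) w - l * (\<Sum>i<N. v j i * w i)"
      by (simp add: g_def B_def right_diff_distrib sum_subtractf sum_distrib_left mult_ac)
    also have "B (v j) w = B w (v j)" by (rule Bsym)
    also have "\<dots> = (\<Sum>i<N. w i * (lam j * v j i))" using eig[OF that] by (simp add: B_def)
    also have "\<dots> = lam j * (\<Sum>i<N. v j i * w i)" by (simp add: sum_distrib_left mult_ac)
    finally show ?thesis using wo[OF that] by simp
  qed
  have gw: "(\<Sum>i<N. g i * w i) = 0"
  proof -
    have "(\<Sum>i<N. g i * w i) = (\<Sum>i<N. w i * (\<Sum>k<N. A i k * w k) - l * (w i)\<^sup>2)"
      by (intro sum.cong) (simp_all add: g_def algebra_simps power2_eq_square)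
    also have "\<dots> = Q w - l * n w"
      by (simp add: Q_def B_def n_def sum_subtractf flip: sum_distrib_left)
    finally have "(\<Sum>i<N. g i * w i) = Q w - l * n w" .
    then show ?thesis using w1 by (simp add: l_def)
  qed
  have Bgw: "B g w = n g"
  proof -
    have "B g w = (\<Sum>i<N. g i * (g i + l * w i))" by (simp add: B_def g_def)
    also have "\<dots> = n g + l * (\<Sum>i<N. g i * w i)"
      by (simp add: n_def distrib_left sum.distrib sum_distrib_left power2_eq_square mult_ac)
    finally show ?thesis using gw by simp
  qed
  have var: "2 * t * n g \<le> t\<^sup>2 * (l * n g - Q g)" for t
  proof -
    define z where "z i = w i + t * g i" for i
    have nz: "n z = 1 + t\<^sup>2 * n g"
    proof -
      have "n z = n w + 2 * t * (\<Sum>i<N. g i * w i) + t\<^sup>2 * n g"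
        by (simp add: n_def z_def power2_sum sum.distrib sum_distrib_left power_mult_distrib mult_ac)
      then show ?thesis using gw w1 by simp
    qed
    have ng: "n g \<ge> 0" by (simp add: n_def sum_nonneg)
    have "Q z = Q w + t * B w g + t * B g w + t\<^sup>2 * Q g"
      by (simp add: Q_def B_def z_def distrib_left distrib_right sum.distrib sum_distrib_left power2_eq_square mult_ac)
    moreover have "Q z \<le> l * n z"
    proof (rule bound)
      show "(\<Sum>i<N. v j i * z i) = 0" if "j < m" for j
      proof -
        have "(\<Sum>i<N. v j i * z i) = (\<Sum>i<N. v j i * w i) + t * (\<Sum>i<N. v j i * g i)"
          by (simp add: z_def distrib_left sum.distrib sum_distrib_left mult_ac)
        then show ?thesis using wo[OF that] go[OF that] by simp
      qed
      show "n z > 0" unfolding nz using ng by (simp add: add_pos_nonneg)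
    qed
    ultimately have "l + 2 * t * n g + t\<^sup>2 * Q g \<le> l * (1 + t\<^sup>2 * n g)"
      using Bsym[of w g] Bgw by (simp add: nz l_def)
    then show ?thesis by (simp add: algebra_simps)
  qed
  have "n g = 0"
  proof (rule ccontr)
    assume "n g \<noteq> 0"
    then have ng: "n g > 0" by (simp add: n_def sum_nonneg order_less_le)
    define c where "c = \<bar>l * n g - Q g\<bar> + 1"
    have c: "c > 0" "l * n g - Q g < c" by (auto simp: c_def)
    define t where "t = n g / c"
    have t: "t > 0" using ng c by (simp add: t_def)
    have "t * (2 * n g) \<le> t * (t * (l * n g - Q g))" using var[of t] by (simp add: power2_eq_square mult_ac)
    then have "2 * n g \<le> t * (l * n g - Q g)" using t by simp
    also have "\<dots> \<le> t * c" using t c by (intro mult_left_mono) auto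
    also have "\<dots> = n g" using c by (simp add: t_def)
    finally show False using ng by simp
  qed
  then have "g i = 0" if "i < N" for i using that by (auto simp: n_def sum_nonneg_eq_0_iff)
  then show ?thesis using w1 wo by (intro exI[of _ w] exI[of _ l]) (auto simp: g_def n_def)
qed

lemma orthonormal_eigenbasis_extending:
  fixes A :: "nat \<Rightarrow> nat \<Rightarrow> real" and v0 :: "nat \<Rightarrow> real"
  assumes sym: "\<And>i k. i < N \<Longrightarrow> k < N \<Longrightarrow> A i k = A k i"
    and unit: "(\<Sum>i<N. (v0 i)\<^sup>2) = 1"
    and eig0: "\<And>i. i < N \<Longrightarrow> (\<Sum>k<N. A i k * v0 k) = l0 * v0 i"
    and "0 < N"
  shows "\<exists>v lam. orthonormal N N v \<and> v 0 = v0 \<and> lam 0 = l0 \<and>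
            (\<forall>j<N. \<forall>i<N. (\<Sum>k<N. A i k * v j k) = lam j * v j i)"
proof -
  have "\<exists>v lam. orthonormal N (Suc m) v \<and> v 0 = v0 \<and> lam 0 = l0 \<and>
            (\<forall>j<Suc m. \<forall>i<N. (\<Sum>k<N. A i k * v j k) = lam j * v j i)" if "Suc m \<le> N" for m
    using that
  proof (induction m)
    case 0
    have "orthonormal N (Suc 0) (\<lambda>_. v0)" using unit by (simp add: orthonormal_def power2_eq_square)
    then show ?case using eig0 by (intro exI[of _ "\<lambda>_. v0"] exI[of _ "\<lambda>_. l0"]) auto
  next
    case (Suc m)
    then obtain v lam where v: "orthonormal N (Suc m) v" "v 0 = v0" "lam 0 = l0"
      and eig: "\<And>j i. j < Suc m \<Longrightarrow> i < N \<Longrightarrow> (\<Sum>k<N. A i k * v j k) = lam j * v j i" by auto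
    obtain w l where w: "(\<Sum>i<N. (w i)\<^sup>2) = 1" "\<And>j. j < Suc m \<Longrightarrow> (\<Sum>i<N. v j i * w i) = 0"
      and weig: "\<And>i. i < N \<Longrightarrow> (\<Sum>k<N. A i k * w k) = l * w i"
      using eigenvector_orthogonal_to_eigenvectors[OF sym v(1) _ eig] Suc.prems by auto
    have "orthonormal N (Suc (Suc m)) (v(Suc m := w))"
    proof -
      have "(\<Sum>i<N. w i * v j i) = 0" if "j < Suc m" for j
        using w(2)[OF that] by (simp only: mult.commute)
      then show ?thesis
        using v(1) w unfolding orthonormal_def power2_eq_square by (auto simp: less_Suc_eq)
    qed
    moreover have "(\<Sum>k<N. A i k * (v(Suc m := w)) j k) = (lam(Suc m := l)) j * (v(Suc m := w)) j i"
      if "j < Suc (Suc m)" "i < N" for i j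
      using that eig weig by (auto simp: less_Suc_eq)
    moreover have "(v(Suc m := w)) 0 = v0" "(lam(Suc m := l)) 0 = l0" using v by simp_all
    ultimately show ?case by blast
  qed
  from this[of "N - 1"] show ?thesis using \<open>0 < N\<close> by simp
qed

section \<open>Decay of the whole network\<close>

lemma objective_class_sector:
  assumes "f \<in> objective_class N \<mu> L" "\<mu> \<le> L" "i < N"
  shows "inner ((gradient (f i) x - gradient (f i) y) - \<mu> *\<^sub>R (x - y))
               ((gradient (f i) x - gradient (f i) y) - L *\<^sub>R (x - y)) \<le> 0"
  by (rule cocoercivity_sector[of "f i"]) (use assms in \<open>auto simp: objective_class_def\<close>)

lemma sum_gradient_zero_at_minimizer:
  assumes f: "f \<in> objective_class N \<mu> L" and min: "is_arg_min (\<lambda>z. \<Sum>i<N. f i z) (\<lambda>_. True) xs"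
  shows "(\<Sum>i<N. gradient (f i) xs) = 0"
proof (rule gradient_zero_at_minimizer)
  fix z
  have "(\<Sum>i<N. f i z) \<le> (\<Sum>i<N. f i xs + inner (gradient (f i) xs) (z - xs) + L / 2 * (norm (z - xs))\<^sup>2)"
    using f by (intro sum_mono) (auto simp: objective_class_def)
  then show "(\<Sum>i<N. f i z) \<le> (\<Sum>i<N. f i xs) + inner (\<Sum>i<N. gradient (f i) xs) (z - xs)
      + (real N * (L / 2)) * (norm (z - xs))\<^sup>2"
    by (simp add: sum.distrib inner_sum_left)
  show "(\<Sum>i<N. f i xs) \<le> (\<Sum>i<N. f i z)"
    using min by (auto simp: is_arg_min_def not_less)
qed

lemma graph_class_sum_neighbours:
  fixes z :: "nat \<Rightarrow> 'a::real_vector"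
  assumes "(Nb, W) \<in> graph_class N \<sigma>" "i < N"
  shows "(\<Sum>j\<in>Nb i. W $$ (i, j) *\<^sub>R z j) = (\<Sum>j<N. W $$ (i, j) *\<^sub>R z j)"
  using assms by (intro sum.mono_neutral_left) (auto simp: graph_class_def)

lemma graph_class_symmetric:
  assumes "(Nb, W) \<in> graph_class N \<sigma>" "i < N" "j < N"
  shows "W $$ (i, j) = W $$ (j, i)"
proof -
  have "W \<in> carrier_mat N N" "transpose_mat W = W" using assms by (auto simp: graph_class_def)
  then show ?thesis using assms(2,3) index_transpose_mat(1)[of j W i] by (metis carrier_matD)
qed

lemma graph_class_row_sum:
  assumes "(Nb, W) \<in> graph_class N \<sigma>" "i < N"
  shows "(\<Sum>j<N. W $$ (i, j)) = 1"
proof -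
  have W: "W \<in> carrier_mat N N" "W *\<^sub>v vec N (\<lambda>_. 1) = vec N (\<lambda>_. 1)"
    using assms by (auto simp: graph_class_def)
  have "(W *\<^sub>v vec N (\<lambda>_. 1)) $ i = 1" unfolding W(2) using assms by simp
  then show ?thesis using W(1) assms(2) by (simp add: scalar_prod_def lessThan_atLeast0)
qed

text \<open>
  On vectors with entries summing to zero, \<open>W\<close> and \<open>W - \<one>\<one>\<^sup>T / N\<close> act in the same way.
\<close>

lemma mixing_norm_eigenvalue:
  assumes W: "W \<in> carrier_mat N N" and "0 < N"
    and eig: "\<And>i. i < N \<Longrightarrow> (\<Sum>k<N. W $$ (i, k) * w k) = l * w i"
    and w0: "(\<Sum>i<N. w i) = 0" and w1: "(\<Sum>i<N. (w i)\<^sup>2) = 1"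
  shows "\<bar>l\<bar> \<le> mixing_norm N W"
proof -
  define M where "M = map_mat complex_of_real (W - mat N N (\<lambda>_. 1 / real N))"
  define z where "z = vec N (\<lambda>i. complex_of_real (w i))"
  have M: "M \<in> carrier_mat N N" using W by (simp add: M_def minus_carrier_mat)
  have "z \<noteq> 0\<^sub>v N"
  proof
    assume "z = 0\<^sub>v N"
    then have "w i = 0" if "i < N" for i using that
      by (metis index_vec index_zero_vec(1) of_real_eq_0_iff z_def)
    then show False using w1 by simp
  qed
  moreover have "M *\<^sub>v z = complex_of_real l \<cdot>\<^sub>v z"
  proof (rule eq_vecI)
    fix i assume "i < dim_vec (complex_of_real l \<cdot>\<^sub>v z)"
    then have i: "i < N" by (simp add: z_def)
    have "(M *\<^sub>v z) $ i = (\<Sum>k<N. complex_of_real ((W $$ (i, k) - 1 / real N) * w k))"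
      using i W by (simp add: M_def z_def scalar_prod_def lessThan_atLeast0)
    also have "\<dots> = complex_of_real ((\<Sum>k<N. W $$ (i, k) * w k) - (1 / real N) * (\<Sum>k<N. w k))"
      by (simp add: left_diff_distrib sum_subtractf sum_distrib_left sum_divide_distrib)
    also have "\<dots> = (complex_of_real l \<cdot>\<^sub>v z) $ i" using i eig[OF i] w0 by (simp add: z_def)
    finally show "(M *\<^sub>v z) $ i = (complex_of_real l \<cdot>\<^sub>v z) $ i" .
  qed (use M in \<open>simp add: z_def\<close>)
  ultimately have "eigenvector M z (complex_of_real l)"
    using M by (simp add: eigenvector_def z_def)
  then have "complex_of_real l \<in> spectrum M" by (auto simp: spectrum_def eigenvalue_def)
  then have "norm (complex_of_real l) \<le> spectral_radius M"
    using spectral_radius_mem_max(2)[OF M \<open>0 < N\<close>] by blast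
  then show ?thesis by (simp add: mixing_norm_def M_def)
qed

text \<open>
  The Lyapunov functions of all modes are added. Each mode contributes its part of the sector
  expression, and by Parseval's identity the parts add up to the sum over the agents, which is
  nonpositive. The modes themselves need not satisfy a sector inequality, because different agents
  have different nonlinear gradients.
\<close>

lemma DIGing_geometric_decay:
  fixes f :: "nat \<Rightarrow> 'a::euclidean_space \<Rightarrow> real"
  assumes N: "0 < N" and f: "f \<in> objective_class N \<mu> L" and G: "(Nb, W) \<in> graph_class N \<sigma>"
    and alg: "DIGing N Nb W f \<alpha> x y" and min: "is_arg_min (\<lambda>z. \<Sum>i<N. f i z) (\<lambda>_. True) xs"
    and pos: "0 < \<alpha>" "0 < \<mu>" "\<mu> \<le> L" "0 \<le> \<sigma>" and r: "\<sigma> < r" "r \<le> 1"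
    and slow: "1 - r < \<alpha> * \<mu>" and small: "\<alpha> * L * (1 + r) < (r - \<sigma>)\<^sup>2"
    and i: "i < N"
  shows "\<exists>C. \<forall>k. norm (x k i - xs) \<le> C * r ^ k"
proof -
  have r0: "r > 0" using pos r by simp
  have bL: "\<alpha> * L < 1 + r"
  proof -
    have "(r - \<sigma>)\<^sup>2 \<le> (1 + r)\<^sup>2" using r pos by (intro power_mono) auto
    then have "\<alpha> * L * (1 + r) < (1 + r) * (1 + r)" using small by (simp add: power2_eq_square)
    then show ?thesis using r0 by simp
  qed
  define A where "A i k = W $$ (i, k)" for i k
  define e where "e k i = x k i - xs" for k i
  define u where "u k i = gradient (f i) (x k i) - gradient (f i) xs" for k i
  define s where "s k i = y k i - u k i" for k i
  note nb = graph_class_sum_neighbours[OF G, folded A_def]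
  have sym: "A i k = A k i" if "i < N" "k < N" for i k
    using graph_class_symmetric[OF G that] by (simp add: A_def)
  have row: "(\<Sum>j<N. A i j) = 1" if "i < N" for i
    using graph_class_row_sum[OF G that] by (simp add: A_def)
  have alg0: "y 0 i = gradient (f i) (x 0 i)"
    and algx: "x (Suc k) i = (\<Sum>j<N. A i j *\<^sub>R x k j) - \<alpha> *\<^sub>R y k i"
    and algy: "y (Suc k) i = (\<Sum>j<N. A i j *\<^sub>R y k j) + gradient (f i) (x (Suc k) i) - gradient (f i) (x k i)"
    if "i < N" for i k
    using alg that unfolding DIGing_def by (auto simp: A_def[symmetric] nb[OF that])
  have e_Suc: "e (Suc k) i = (\<Sum>j<N. A i j *\<^sub>R e k j) - \<alpha> *\<^sub>R s k i - \<alpha> *\<^sub>R u k i" if i: "i < N" for i k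
  proof -
    have "(\<Sum>j<N. A i j *\<^sub>R e k j) = (\<Sum>j<N. A i j *\<^sub>R x k j) - (\<Sum>j<N. A i j) *\<^sub>R xs"
      by (simp add: e_def scaleR_diff_right sum_subtractf scaleR_sum_left)
    then show ?thesis using i by (simp add: e_def s_def algx row scaleR_diff_right)
  qed
  have s_Suc: "s (Suc k) i = (\<Sum>j<N. A i j *\<^sub>R s k j) + (\<Sum>j<N. A i j *\<^sub>R u k j) - u k i" if i: "i < N" for i k
    using i by (simp add: s_def u_def algy scaleR_diff_right sum_subtractf)
  \<comment> \<open>The consensus direction comes first in the eigenbasis; all other eigenvectors are orthogonal to it.\<close>
  define v0 :: "nat \<Rightarrow> real" where "v0 i = 1 / sqrt N" for i
  have "(\<Sum>i<N. (v0 i)\<^sup>2) = 1" using N by (simp add: v0_def power_divide)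
  moreover have "(\<Sum>k<N. A i k * v0 k) = 1 * v0 i" if "i < N" for i
    using row[OF that] by (simp add: v0_def flip: sum_divide_distrib)
  ultimately obtain v lam where v: "orthonormal N N v" "v 0 = v0" "lam 0 = 1"
    and eig: "\<And>j i. j < N \<Longrightarrow> i < N \<Longrightarrow> (\<Sum>k<N. A i k * v j k) = lam j * v j i"
    using orthonormal_eigenbasis_extending[of N A v0 1] sym N by auto
  define M where "M j p = (\<Sum>i<N. v j i *\<^sub>R p i)" for j and p :: "nat \<Rightarrow> 'a"
  have M_W: "M j (\<lambda>i. \<Sum>k<N. A i k *\<^sub>R p k) = lam j *\<^sub>R M j p" if j: "j < N" for j p
  proof -
    have "M j (\<lambda>i. \<Sum>k<N. A i k *\<^sub>R p k) = (\<Sum>k<N. \<Sum>i<N. (v j i * A i k) *\<^sub>R p k)"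
      unfolding M_def by (simp add: scaleR_sum_right) (rule sum.swap)
    also have "\<dots> = (\<Sum>k<N. (\<Sum>i<N. A k i * v j i) *\<^sub>R p k)"
      unfolding scaleR_sum_left using sym by (intro sum.cong refl) (simp add: mult.commute)
    also have "\<dots> = lam j *\<^sub>R M j p" using eig[OF j] by (simp add: M_def scaleR_sum_right)
    finally show ?thesis .
  qed
  have M_lin: "M j (\<lambda>i. p i + q i) = M j p + M j q" "M j (\<lambda>i. p i - q i) = M j p - M j q"
    "M j (\<lambda>i. c *\<^sub>R p i) = c *\<^sub>R M j p" for j p q c
    by (simp_all add: M_def scaleR_add_right scaleR_diff_right sum.distrib sum_subtractf scaleR_sum_right mult.commute)
  have M_cong: "M j p = M j q" if "\<And>i. i < N \<Longrightarrow> p i = q i" for j p q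
    unfolding M_def using that by (intro sum.cong) auto
  have Me: "M j (e (Suc k)) = lam j *\<^sub>R M j (e k) - \<alpha> *\<^sub>R M j (s k) - \<alpha> *\<^sub>R M j (u k)" if j: "j < N" for j k
    by (subst M_cong[OF e_Suc], assumption) (simp add: M_lin M_W[OF j])
  have Ms: "M j (s (Suc k)) = lam j *\<^sub>R M j (s k) + (lam j - 1) *\<^sub>R M j (u k)" if j: "j < N" for j k
    by (subst M_cong[OF s_Suc], assumption) (simp add: M_lin M_W[OF j] scaleR_diff_left)
  \<comment> \<open>This is where the initialization enters: \<open>s 0\<close> consists of the gradients at the minimizer, which sum to zero.\<close>
  have Ms0: "M 0 (s k) = 0" for k
  proof (induction k)
    case 0
    have "M 0 (s 0) = (1 / sqrt N) *\<^sub>R (\<Sum>i<N. gradient (f i) xs)"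
      unfolding M_def v(2) v0_def scaleR_sum_right by (intro sum.cong) (auto simp: s_def u_def alg0)
    then show ?case using sum_gradient_zero_at_minimizer[OF f min] by simp
  next
    case (Suc k)
    then show ?case using Ms[OF N] v(3) by simp
  qed
  have lam: "\<bar>lam j\<bar> \<le> \<sigma>" if j: "j < N" "j \<noteq> 0" for j
  proof -
    have "(\<Sum>i<N. v 0 i * v j i) = 0" using v(1) N j by (simp add: orthonormal_def)
    then have "(\<Sum>i<N. v j i) = 0" using N by (simp add: v(2) v0_def flip: sum_divide_distrib)
    moreover have "(\<Sum>i<N. (v j i)\<^sup>2) = 1" using v(1) j by (simp add: orthonormal_def power2_eq_square)
    ultimately have "\<bar>lam j\<bar> \<le> mixing_norm N W"
      using mixing_norm_eigenvalue[of W N "v j" "lam j"] eig[OF j(1)] G N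
      by (auto simp: A_def graph_class_def)
    then show ?thesis using G by (auto simp: graph_class_def)
  qed
  have "\<exists>V K. 0 < K \<and> (\<forall>k. (norm (M j (e k)))\<^sup>2 \<le> K * V k \<and>
            V (Suc k) - r\<^sup>2 * V k \<le> inner (M j (u k) - \<mu> *\<^sub>R M j (e k)) (M j (u k) - L *\<^sub>R M j (e k)))"
    if j: "j < N" for j
  proof (cases "j = 0")
    case True
    have "M 0 (e (Suc k)) = M 0 (e k) - \<alpha> *\<^sub>R M 0 (u k)" for k
      using Me[OF N] Ms0 v(3) by simp
    then show ?thesis
      unfolding True using consensus_mode_lyapunov[of \<alpha> r \<mu> L "\<lambda>k. M 0 (e k)" "\<lambda>k. M 0 (u k)"] pos r0 slow bL by simp
  next
    case False
    show ?thesis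
      using disagreement_mode_lyapunov[of \<alpha> \<mu> L \<sigma> r "lam j" "\<lambda>k. M j (e k)" "\<lambda>k. M j (s k)" "\<lambda>k. M j (u k)"]
        pos r lam[OF j False] small Me[OF j] Ms[OF j] by blast
  qed
  then obtain V K where K: "\<And>j. j < N \<Longrightarrow> 0 < K j"
    and VK: "\<And>j k. j < N \<Longrightarrow> (norm (M j (e k)))\<^sup>2 \<le> K j * V j k"
    and V: "\<And>j k. j < N \<Longrightarrow> V j (Suc k) - r\<^sup>2 * V j k
        \<le> inner (M j (u k) - \<mu> *\<^sub>R M j (e k)) (M j (u k) - L *\<^sub>R M j (e k))"
    by metis
  have V0: "V j k \<ge> 0" if "j < N" for j k
  proof -
    have "0 \<le> K j * V j k" using VK[OF that] zero_le_power2 order_trans by blast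
    then show ?thesis using K[OF that] by (simp add: zero_le_mult_iff)
  qed
  define T where "T k = (\<Sum>j<N. V j k)" for k
  have T_Suc: "T (Suc k) \<le> r\<^sup>2 * T k" for k
  proof -
    have "T (Suc k) - r\<^sup>2 * T k = (\<Sum>j<N. V j (Suc k) - r\<^sup>2 * V j k)"
      by (simp add: T_def sum_subtractf sum_distrib_left)
    also have "\<dots> \<le> (\<Sum>j<N. inner (M j (\<lambda>i. u k i - \<mu> *\<^sub>R e k i)) (M j (\<lambda>i. u k i - L *\<^sub>R e k i)))"
      using V by (intro sum_mono) (simp add: M_lin)
    also have "\<dots> = (\<Sum>i<N. inner (u k i - \<mu> *\<^sub>R e k i) (u k i - L *\<^sub>R e k i))"
      unfolding M_def by (rule orthonormal_parseval[OF v(1)])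
    also have "\<dots> \<le> 0"
      using objective_class_sector[OF f pos(3)] by (intro sum_nonpos) (simp add: u_def e_def)
    finally show ?thesis by simp
  qed
  have T: "T k \<le> (r ^ k)\<^sup>2 * T 0" for k
  proof (induction k)
    case (Suc k)
    have "T (Suc k) \<le> r\<^sup>2 * ((r ^ k)\<^sup>2 * T 0)" using T_Suc[of k] Suc
      by (meson mult_left_mono order_trans zero_le_power2)
    then show ?case by (simp add: power_mult_distrib mult_ac)
  qed simp
  have T0: "T 0 \<ge> 0" unfolding T_def using V0 by (intro sum_nonneg) auto
  have Mb: "norm (M j (e k)) \<le> sqrt (K j * T 0) * r ^ k" if j: "j < N" for j k
  proof -
    have "V j k \<le> T k" using V0 j unfolding T_def by (intro member_le_sum) auto
    then have "V j k \<le> (r ^ k)\<^sup>2 * T 0" using T[of k] by simp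
    then have "K j * V j k \<le> K j * ((r ^ k)\<^sup>2 * T 0)" using K[OF j] by simp
    then have "(norm (M j (e k)))\<^sup>2 \<le> (K j * T 0) * (r ^ k)\<^sup>2" using VK[OF j, of k] by (simp add: mult_ac)
    also have "\<dots> = (sqrt (K j * T 0) * r ^ k)\<^sup>2" using K[OF j] T0 by (simp add: power_mult_distrib)
    finally show ?thesis by (rule power2_le_imp_le) (use r0 K[OF j] T0 in simp)
  qed
  show ?thesis
  proof (intro exI allI)
    fix k
    have "norm (e k i) = norm (\<Sum>j<N. v j i *\<^sub>R M j (e k))"
      using orthonormal_expand[OF v(1) i, of "e k"] by (simp add: M_def)
    also have "\<dots> \<le> (\<Sum>j<N. \<bar>v j i\<bar> * norm (M j (e k)))" by (rule order_trans[OF norm_sum]) simp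
    also have "\<dots> \<le> (\<Sum>j<N. \<bar>v j i\<bar> * (sqrt (K j * T 0) * r ^ k))"
      using Mb by (intro sum_mono mult_left_mono) auto
    also have "\<dots> = (\<Sum>j<N. \<bar>v j i\<bar> * sqrt (K j * T 0)) * r ^ k" by (simp only: sum_distrib_right mult.assoc)
    finally show "norm (x k i - xs) \<le> (\<Sum>j<N. \<bar>v j i\<bar> * sqrt (K j * T 0)) * r ^ k" by (simp add: e_def)
  qed
qed

section \<open>Worst-case objectives and graphs\<close>

lemma gradient_eqI:
  assumes "GDERIV f x :> D" shows "gradient f x = D"
  unfolding gradient_def
proof (rule the_equality)
  show "GDERIV f x :> D" by (rule assms)
  fix D' assume "GDERIV f x :> D'"
  then have "(\<lambda>h. inner h D') = (\<lambda>h. inner h D)"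
    using assms unfolding gderiv_def by (rule has_derivative_unique)
  then have "\<forall>h. inner h D' = inner h D" by (simp add: fun_eq_iff)
  then show "D' = D" by (rule vector_eq_ldot[THEN iffD1])
qed

lemma gderiv_half_square: "GDERIV (\<lambda>z. h / 2 * (norm z)\<^sup>2) x :> h *\<^sub>R x"
proof -
  have "((\<lambda>z. h / 2 * inner z z) has_derivative (\<lambda>d. h / 2 * (inner x d + inner d x))) (at x)"
    by (auto intro!: derivative_eq_intros)
  moreover have "(\<lambda>d. h / 2 * (inner x d + inner d x)) = (\<lambda>d. inner d (h *\<^sub>R x))"
    by (rule ext) (simp add: inner_commute[of x])
  ultimately show ?thesis by (simp only: gderiv_def power2_norm_eq_inner)
qed

lemma gradient_half_square: "gradient (\<lambda>z. h / 2 * (norm z)\<^sup>2) x = h *\<^sub>R x"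
  using gderiv_half_square[of h x] by (rule gradient_eqI)

lemma half_square_in_objective_class:
  assumes "\<mu> \<le> h" "h \<le> L"
  shows "(\<lambda>_ (z :: 'a::euclidean_space). h / 2 * (norm z)\<^sup>2) \<in> objective_class N \<mu> L"
proof -
  have expand: "h / 2 * (norm y)\<^sup>2 = h / 2 * (norm x)\<^sup>2 + inner (h *\<^sub>R x) (y - x) + h / 2 * (norm (y - x))\<^sup>2" for x y :: 'a
  proof -
    have "(norm (y - x))\<^sup>2 = (norm y)\<^sup>2 - 2 * inner x y + (norm x)\<^sup>2"
      unfolding power2_norm_eq_inner by (simp add: inner_diff_left inner_diff_right inner_commute[of y x])
    moreover have "inner (h *\<^sub>R x) (y - x) = h * inner x y - h * (norm x)\<^sup>2"
      unfolding power2_norm_eq_inner by (simp add: inner_diff_right right_diff_distrib)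
    ultimately show ?thesis by (simp only:) (simp add: field_simps)
  qed
  have bounds: "\<mu> / 2 * t\<^sup>2 \<le> h / 2 * t\<^sup>2" "h / 2 * t\<^sup>2 \<le> L / 2 * t\<^sup>2" for t :: real
    using mult_right_mono[OF assms(1), of "t\<^sup>2"] mult_right_mono[OF assms(2), of "t\<^sup>2"] by simp_all
  have diff: "(\<lambda>z :: 'a. h / 2 * (norm z)\<^sup>2) differentiable (at x)" for x
    using gderiv_half_square[of h x] unfolding gderiv_def differentiable_def by blast
  have "h / 2 * (norm x)\<^sup>2 + inner (h *\<^sub>R x) (y - x) + \<mu> / 2 * (norm (y - x))\<^sup>2 \<le> h / 2 * (norm y)\<^sup>2"
    "h / 2 * (norm y)\<^sup>2 \<le> h / 2 * (norm x)\<^sup>2 + inner (h *\<^sub>R x) (y - x) + L / 2 * (norm (y - x))\<^sup>2"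
    for x y :: 'a
    using bounds[of "norm (y - x)"] unfolding expand[of y x] by linarith+
  then show ?thesis using diff unfolding objective_class_def mem_Collect_eq gradient_half_square by blast
qed

definition swap01 :: "nat \<Rightarrow> nat" where
  "swap01 i = (if i = 0 then 1 else if i = 1 then 0 else i)"

text \<open>
  Averaging with weight \<open>1 - \<sigma>\<close> and exchanging the agents \<open>0\<close> and \<open>1\<close> with weight \<open>\<sigma>\<close>. This has the
  eigenvalue \<open>- \<sigma>\<close> for every \<open>N\<close>, and all weights are positive if \<open>0 \<le> \<sigma> < 1\<close>.
\<close>

definition swap_weights :: "nat \<Rightarrow> real \<Rightarrow> real mat" where
  "swap_weights N \<sigma> = mat N N (\<lambda>(i, k). (1 - \<sigma>) / real N + \<sigma> * of_bool (k = swap01 i))"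

lemma swap01_swap01 [simp]: "swap01 (swap01 i) = i"
  by (auto simp: swap01_def)

lemma sum_swap01: "N \<ge> 2 \<Longrightarrow> (\<Sum>i<N. g (swap01 i)) = (\<Sum>i<N. g i)"
  by (rule sum.reindex_bij_witness[of _ swap01 swap01]) (auto simp: swap01_def)

lemma swap_weights_sum:
  fixes z :: "nat \<Rightarrow> 'a::real_vector"
  assumes "N \<ge> 2" "i < N"
  shows "(\<Sum>k<N. swap_weights N \<sigma> $$ (i, k) *\<^sub>R z k)
    = ((1 - \<sigma>) / real N) *\<^sub>R (\<Sum>k<N. z k) + \<sigma> *\<^sub>R z (swap01 i)"
proof -
  have "swap01 i < N" using assms by (auto simp: swap01_def)
  then have "(\<Sum>k<N. (\<sigma> * of_bool (k = swap01 i)) *\<^sub>R z k) = \<sigma> *\<^sub>R z (swap01 i)"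
    by (simp add: of_bool_def if_distrib if_distribR cong: if_cong)
  then show ?thesis using assms
    by (simp add: swap_weights_def scaleR_add_left sum.distrib scaleR_sum_right)
qed

text \<open>
  For an eigenvector with nonzero eigenvalue, summing the eigenvalue equations shows that the
  entries sum to zero, since the exchange preserves the sum. Then the matrix acts as \<open>\<sigma>\<close> times the
  exchange, and the sums of absolute values on both sides give the modulus of the eigenvalue.
\<close>

lemma mixing_norm_swap_weights:
  assumes N: "N \<ge> 2" and \<sigma>: "0 \<le> \<sigma>"
  shows "mixing_norm N (swap_weights N \<sigma>) \<le> \<sigma>"
proof -
  define M where "M = map_mat complex_of_real (swap_weights N \<sigma> - mat N N (\<lambda>_. 1 / real N))"
  have M: "M \<in> carrier_mat N N" by (simp add: M_def minus_carrier_mat)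
  obtain l where l: "l \<in> spectrum M" "spectral_radius M = norm l"
    using spectral_radius_mem_max(1)[OF M] N by auto
  then obtain z where z: "eigenvector M z l" by (auto simp: spectrum_def eigenvalue_def)
  define c where "c k = z $ k" for k
  have zN: "dim_vec z = N" "z \<noteq> 0\<^sub>v N" "M *\<^sub>v z = l \<cdot>\<^sub>v z" using z M by (auto simp: eigenvector_def)
  have row: "l * c i = complex_of_real \<sigma> * (c (swap01 i) - (\<Sum>k<N. c k) / of_nat N)" if i: "i < N" for i
  proof -
    have sw: "swap01 i < N" using i N by (auto simp: swap01_def)
    have "l * c i = (M *\<^sub>v z) $ i" using zN i by (simp add: c_def)
    also have "\<dots> = (\<Sum>k<N. complex_of_real ((1 - \<sigma>) / real N + \<sigma> * of_bool (k = swap01 i) - 1 / real N) * c k)"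
    proof -
      have "(M *\<^sub>v z) $ i = (\<Sum>k<N. M $$ (i, k) * z $ k)"
        using i M zN(1) by (simp add: scalar_prod_def lessThan_atLeast0)
      then show ?thesis using i by (simp add: M_def swap_weights_def c_def)
    qed
    also have "\<dots> = (\<Sum>k<N. complex_of_real \<sigma> * (of_bool (k = swap01 i) * c k) - complex_of_real \<sigma> / of_nat N * c k)"
    proof (intro sum.cong refl)
      fix k
      have "(1 - \<sigma>) / real N + \<sigma> * of_bool (k = swap01 i) - 1 / real N = \<sigma> * of_bool (k = swap01 i) - \<sigma> / real N"
        by (simp add: diff_divide_distrib)
      then show "complex_of_real ((1 - \<sigma>) / real N + \<sigma> * of_bool (k = swap01 i) - 1 / real N) * c k
         = complex_of_real \<sigma> * (of_bool (k = swap01 i) * c k) - complex_of_real \<sigma> / of_nat N * c k"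
        by (simp only:) (simp add: left_diff_distrib)
    qed
    also have "\<dots> = complex_of_real \<sigma> * (\<Sum>k<N. of_bool (k = swap01 i) * c k) - complex_of_real \<sigma> / of_nat N * (\<Sum>k<N. c k)"
      by (simp only: sum_subtractf sum_distrib_left)
    also have "(\<Sum>k<N. of_bool (k = swap01 i) * c k) = c (swap01 i)"
      using sw by (simp add: of_bool_def if_distrib if_distribR cong: if_cong)
    finally show ?thesis by (simp add: right_diff_distrib)
  qed
  have "norm l \<le> \<sigma>"
  proof (cases "l = 0")
    case False
    have "l * (\<Sum>i<N. c i) = (\<Sum>i<N. complex_of_real \<sigma> * (c (swap01 i) - (\<Sum>k<N. c k) / of_nat N))"
      using row by (simp add: sum_distrib_left)
    also have "\<dots> = complex_of_real \<sigma> * ((\<Sum>i<N. c (swap01 i)) - (\<Sum>k<N. c k))"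
      using N by (simp add: sum_subtractf flip: sum_distrib_left)
    also have "\<dots> = 0" by (simp add: sum_swap01[OF N])
    finally have s0: "(\<Sum>i<N. c i) = 0" using False by simp
    have "norm l * (\<Sum>i<N. norm (c i)) = (\<Sum>i<N. norm (l * c i))" by (simp add: sum_distrib_left norm_mult)
    also have "\<dots> = (\<Sum>i<N. \<sigma> * norm (c (swap01 i)))"
      using row s0 \<sigma> by (intro sum.cong) (simp_all add: norm_mult)
    also have "\<dots> = \<sigma> * (\<Sum>i<N. norm (c i))"
      using sum_swap01[OF N, of "\<lambda>i. norm (c i)"] by (simp add: flip: sum_distrib_left)
    finally have eq: "norm l * (\<Sum>i<N. norm (c i)) = \<sigma> * (\<Sum>i<N. norm (c i))" .
    have "\<exists>i<N. c i \<noteq> 0"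
    proof (rule ccontr)
      assume "\<not> ?thesis"
      then have "z = 0\<^sub>v N" using zN(1) by (intro eq_vecI) (auto simp: c_def)
      then show False using zN(2) by simp
    qed
    then have "(\<Sum>i<N. norm (c i)) \<noteq> 0" by (auto simp: sum_nonneg_eq_0_iff)
    then show ?thesis using eq by simp
  qed (use \<sigma> in simp)
  then show ?thesis using l(2) by (simp add: mixing_norm_def M_def)
qed

lemma swap_weights_in_graph_class:
  assumes N: "N \<ge> 2" and \<sigma>: "0 \<le> \<sigma>" "\<sigma> < 1"
  shows "(\<lambda>_. {..<N}, swap_weights N \<sigma>) \<in> graph_class N \<sigma>"
proof -
  let ?W = "swap_weights N \<sigma>"
  have W: "?W \<in> carrier_mat N N" by (simp add: swap_weights_def)
  have "?W $$ (i, j) > 0" if "i < N" "j < N" for i j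
    using that \<sigma> by (simp add: swap_weights_def add_pos_nonneg)
  moreover have "transpose_mat ?W = ?W"
    by (rule eq_matI) (auto simp: swap_weights_def swap01_def of_bool_def)
  moreover have "?W *\<^sub>v vec N (\<lambda>_. 1) = vec N (\<lambda>_. 1)"
  proof (rule eq_vecI)
    fix i assume "i < dim_vec (vec N (\<lambda>_. 1::real))"
    then have i: "i < N" by simp
    have "(?W *\<^sub>v vec N (\<lambda>_. 1)) $ i = (\<Sum>k<N. ?W $$ (i, k) *\<^sub>R 1)"
      using i W by (simp add: scalar_prod_def lessThan_atLeast0)
    also have "\<dots> = 1" using N by (simp only: swap_weights_sum[OF N i]) simp
    finally show "(?W *\<^sub>v vec N (\<lambda>_. 1)) $ i = vec N (\<lambda>_. 1) $ i" using i by simp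
  qed (use W in simp)
  ultimately show ?thesis
    using W \<sigma> mixing_norm_swap_weights[OF N \<sigma>(1)] by (auto simp: graph_class_def)
qed

text \<open>
  The guaranteed convergence, specialised to identical quadratic objectives on the complete
  graph with weights \<open>swap_weights\<close>, with the minimizer at the origin.
\<close>

lemma convergence_at_half_square_swap:
  fixes x y :: "nat \<Rightarrow> nat \<Rightarrow> 'a::euclidean_space"
  assumes conv: "DIGing_converges_at TYPE('a) N \<mu> L \<sigma> \<alpha> \<gamma>"
    and N: "N \<ge> 2" and \<sigma>: "0 \<le> \<sigma>" "\<sigma> < 1" and h: "0 < \<mu>" "\<mu> \<le> h" "h \<le> L"
    and init: "\<And>i. i < N \<Longrightarrow> y 0 i = h *\<^sub>R x 0 i"
    and x: "\<And>k i. i < N \<Longrightarrow> x (Suc k) i = ((1 - \<sigma>) / real N) *\<^sub>R (\<Sum>j<N. x k j) + \<sigma> *\<^sub>R x k (swap01 i) - \<alpha> *\<^sub>R y k i"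
    and y: "\<And>k i. i < N \<Longrightarrow> y (Suc k) i = ((1 - \<sigma>) / real N) *\<^sub>R (\<Sum>j<N. y k j) + \<sigma> *\<^sub>R y k (swap01 i)
              + h *\<^sub>R (x (Suc k) i - x k i)"
    and r: "\<gamma> < r" "r \<le> 1"
  shows "(\<lambda>k. inverse (r ^ k) *\<^sub>R x k 0) \<longlonglongrightarrow> 0"
proof -
  let ?f = "\<lambda>(_::nat) (z::'a). h / 2 * (norm z)\<^sup>2"
  have f: "?f \<in> objective_class N \<mu> L" using h by (intro half_square_in_objective_class)
  have G: "(\<lambda>_. {..<N}, swap_weights N \<sigma>) \<in> graph_class N \<sigma>" by (rule swap_weights_in_graph_class[OF N \<sigma>])
  have alg: "DIGing N (\<lambda>_. {..<N}) (swap_weights N \<sigma>) ?f \<alpha> x y"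
    unfolding DIGing_def gradient_half_square
    by (simp add: init x y swap_weights_sum[OF N] scaleR_diff_right)
  have min: "is_arg_min (\<lambda>z::'a. \<Sum>i<N. ?f i z) (\<lambda>_. True) 0"
    using h by (simp add: is_arg_min_def not_less)
  have "\<forall>r\<in>{\<gamma><..1}. \<forall>i<N. (\<lambda>k. inverse (r ^ k) *\<^sub>R (x k i - 0)) \<longlonglongrightarrow> 0"
    using conv f G alg min unfolding DIGing_converges_at_def by blast
  then show ?thesis using r N by auto
qed

lemma geometric_not_null:
  fixes z u :: real
  assumes "0 < r" "r \<le> \<bar>z\<bar>" and lim: "(\<lambda>k. inverse (r ^ k) * (z ^ k * u)) \<longlonglongrightarrow> 0"
  shows "u = 0"
proof (rule ccontr)
  assume u: "u \<noteq> 0"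
  have ge: "\<bar>u\<bar> \<le> \<bar>inverse (r ^ k) * (z ^ k * u)\<bar>" for k
  proof -
    have "1 \<le> (\<bar>z\<bar> / r) ^ k" using assms by (intro one_le_power) simp
    then have "1 * \<bar>u\<bar> \<le> (\<bar>z\<bar> / r) ^ k * \<bar>u\<bar>" by (intro mult_right_mono) auto
    then show ?thesis using assms by (simp add: abs_mult power_abs power_divide field_simps)
  qed
  have "(\<lambda>k. \<bar>inverse (r ^ k) * (z ^ k * u)\<bar>) \<longlonglongrightarrow> 0" using lim by (rule tendsto_rabs_zero)
  then have "\<bar>u\<bar> \<le> 0" by (rule LIMSEQ_le_const) (use ge in auto)
  then show False using u by simp
qed

text \<open>
  Agents with the common objective \<open>\<mu> / 2 * (norm z)\<^sup>2\<close> that start at the same point perform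
  gradient descent in unison.
\<close>

lemma consensus_mode_bound:
  assumes conv: "DIGing_converges_at TYPE('a::euclidean_space) N \<mu> L \<sigma> \<alpha> \<gamma>"
    and N: "N \<ge> 2" and \<sigma>: "0 \<le> \<sigma>" "\<sigma> < 1" and h: "0 < \<mu>" "\<mu> \<le> L" and r: "\<gamma> < r" "0 < r" "r \<le> 1"
  shows "\<bar>1 - \<alpha> * \<mu>\<bar> < r"
proof (rule ccontr)
  assume "\<not> ?thesis"
  then have ge: "r \<le> \<bar>1 - \<alpha> * \<mu>\<bar>" by simp
  obtain b :: 'a where b: "b \<in> Basis" using nonempty_Basis by blast
  define x where "x k i = (1 - \<alpha> * \<mu>) ^ k *\<^sub>R b" for k and i :: nat
  have "(\<lambda>k. inverse (r ^ k) *\<^sub>R x k 0) \<longlonglongrightarrow> 0"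
  proof (rule convergence_at_half_square_swap[OF conv N \<sigma> h(1) order_refl h(2) _ _ _ r(1,3), of "\<lambda>k i. \<mu> *\<^sub>R x k i"])
    have avg: "((1 - \<sigma>) / real N) *\<^sub>R (\<Sum>j<N. z) + \<sigma> *\<^sub>R z = z" for z :: 'a
      using N by (simp add: sum_constant_scaleR scaleR_diff_left)
    show "x (Suc k) i = ((1 - \<sigma>) / real N) *\<^sub>R (\<Sum>j<N. x k j) + \<sigma> *\<^sub>R x k (swap01 i) - \<alpha> *\<^sub>R \<mu> *\<^sub>R x k i" for k i
      unfolding x_def avg by (simp add: algebra_simps)
    show "\<mu> *\<^sub>R x (Suc k) i = ((1 - \<sigma>) / real N) *\<^sub>R (\<Sum>j<N. \<mu> *\<^sub>R x k j) + \<sigma> *\<^sub>R \<mu> *\<^sub>R x k (swap01 i)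
        + \<mu> *\<^sub>R (x (Suc k) i - x k i)" for k i
      unfolding x_def avg by (simp add: scaleR_diff_right)
  qed simp
  then have "(\<lambda>k. inner (inverse (r ^ k) *\<^sub>R x k 0) b) \<longlonglongrightarrow> inner 0 b" by (intro tendsto_intros)
  then have "(\<lambda>k. inverse (r ^ k) * ((1 - \<alpha> * \<mu>) ^ k * 1)) \<longlonglongrightarrow> 0" using b by (simp add: x_def)
  then show False using geometric_not_null[OF r(2) ge] by fastforce
qed

text \<open>
  Coefficients of \<open>x\<close> and \<open>y\<close> along an eigenvector of \<open>W\<close> with eigenvalue \<open>- \<sigma>\<close>, when all agents
  have the objective \<open>L / 2 * (norm z)\<^sup>2\<close>. The start \<open>(1, L)\<close> is the prescribed initialization of \<open>y\<close>.
\<close>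

primrec alternating_mode :: "real \<Rightarrow> real \<Rightarrow> real \<Rightarrow> nat \<Rightarrow> real \<times> real" where
  "alternating_mode \<sigma> \<alpha> L 0 = (1, L)"
| "alternating_mode \<sigma> \<alpha> L (Suc k) = (let (c, d) = alternating_mode \<sigma> \<alpha> L k; c' = - \<sigma> * c - \<alpha> * d
     in (c', - \<sigma> * d + L * (c' - c)))"

text \<open>
  If the inequality failed, \<open>(z + \<sigma>)\<^sup>2 + \<alpha> * L * (z - 1)\<close> would be negative at \<open>z = - r\<close>, so one of its
  roots would be real and below \<open>- r\<close>. The prescribed initialization excites this root, since
  otherwise the ratio of the first two iterates, \<open>- \<sigma> - \<alpha> * L\<close>, would be the other root, and the
  polynomial does not vanish there.
\<close>

lemma alternating_mode_bound:
  assumes conv: "DIGing_converges_at TYPE('a::euclidean_space) N \<mu> L \<sigma> \<alpha> \<gamma>"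
    and N: "N \<ge> 2" and \<sigma>: "0 \<le> \<sigma>" "\<sigma> < 1" and h: "0 < \<mu>" "\<mu> \<le> L" and \<alpha>: "0 < \<alpha>"
    and r: "\<gamma> < r" "0 < r" "r \<le> 1"
  shows "\<alpha> * L * (1 + r) \<le> (r - \<sigma>)\<^sup>2"
proof (rule ccontr)
  assume "\<not> ?thesis"
  then have neg: "(r - \<sigma>)\<^sup>2 < \<alpha> * L * (1 + r)" by simp
  obtain b :: 'a where b: "b \<in> Basis" using nonempty_Basis by blast
  define c d where "c k = fst (alternating_mode \<sigma> \<alpha> L k)" and "d k = snd (alternating_mode \<sigma> \<alpha> L k)" for k
  have c0: "c 0 = 1" "d 0 = L" by (simp_all add: c_def d_def)
  have c_Suc: "c (Suc k) = - \<sigma> * c k - \<alpha> * d k" for k by (simp add: c_def d_def Let_def split_beta)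
  have d_Suc: "d (Suc k) = - \<sigma> * d k + L * (c (Suc k) - c k)" for k
    by (simp add: c_def d_def Let_def split_beta)
  define w :: "nat \<Rightarrow> real" where "w i = (if i = 0 then 1 else if i = 1 then -1 else 0)" for i
  have w_swap: "w (swap01 i) = - w i" for i by (simp add: w_def swap01_def)
  have w_sum: "(\<Sum>i<N. w i) = 0"
  proof -
    have "(\<Sum>i<N. w i) = - (\<Sum>i<N. w i)" using sum_swap01[OF N, of w] by (simp add: w_swap sum_negf)
    then show ?thesis by simp
  qed
  define x y where "x k i = (c k * w i) *\<^sub>R b" and "y k i = (d k * w i) *\<^sub>R b" for k i
  have avg: "((1 - \<sigma>) / real N) *\<^sub>R (\<Sum>j<N. (p * w j) *\<^sub>R b) = 0" for p
    using w_sum by (simp flip: scaleR_sum_left sum_distrib_left)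
  have lim: "(\<lambda>k. inverse (r ^ k) *\<^sub>R x k 0) \<longlonglongrightarrow> 0"
  proof (rule convergence_at_half_square_swap[OF conv N \<sigma> h(1,2) order_refl _ _ _ r(1,3), of y])
    show "y 0 i = L *\<^sub>R x 0 i" for i by (simp add: x_def y_def c0)
    show "x (Suc k) i = ((1 - \<sigma>) / real N) *\<^sub>R (\<Sum>j<N. x k j) + \<sigma> *\<^sub>R x k (swap01 i) - \<alpha> *\<^sub>R y k i" for k i
      unfolding x_def y_def avg w_swap c_Suc by (simp add: algebra_simps)
    show "y (Suc k) i = ((1 - \<sigma>) / real N) *\<^sub>R (\<Sum>j<N. y k j) + \<sigma> *\<^sub>R y k (swap01 i) + L *\<^sub>R (x (Suc k) i - x k i)" for k i
      unfolding x_def y_def avg w_swap d_Suc by (simp add: algebra_simps)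
  qed
  then have "(\<lambda>k. inner (inverse (r ^ k) *\<^sub>R x k 0) b) \<longlonglongrightarrow> inner 0 b" by (intro tendsto_intros)
  then have c_lim: "(\<lambda>k. inverse (r ^ k) * c k) \<longlonglongrightarrow> 0" using b by (simp add: x_def w_def)
  define P q where "P = 2 * \<sigma> + \<alpha> * L" and "q = \<sigma>\<^sup>2 - \<alpha> * L"
  have aL: "\<alpha> * L > 0" using \<alpha> h by simp
  have rec: "c (Suc (Suc k)) = - P * c (Suc k) - q * c k" for k
    unfolding c_Suc[of "Suc k"] d_Suc c_Suc P_def q_def by (simp add: algebra_simps power2_eq_square)
  have disc: "P\<^sup>2 - 4 * q \<ge> 0"
  proof -
    have "P\<^sup>2 - 4 * q = (\<alpha> * L)\<^sup>2 + 4 * (\<sigma> + 1) * (\<alpha> * L)"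
      unfolding P_def q_def by (simp add: algebra_simps power2_eq_square)
    then show ?thesis using aL \<sigma> by simp
  qed
  define z1 z2 where "z1 = (- P - sqrt (P\<^sup>2 - 4 * q)) / 2" and "z2 = (- P + sqrt (P\<^sup>2 - 4 * q)) / 2"
  have z_le: "z1 \<le> z2" using disc by (simp add: z1_def z2_def)
  have z_sum: "z1 + z2 = - P" by (simp add: z1_def z2_def field_simps)
  have z_prod: "z1 * z2 = q"
  proof -
    have "z1 * z2 = (P\<^sup>2 - (sqrt (P\<^sup>2 - 4 * q))\<^sup>2) / 4"
      by (simp add: z1_def z2_def power2_eq_square algebra_simps)
    then show ?thesis using disc by simp
  qed
  have fac: "(t - z1) * (t - z2) = (t + \<sigma>)\<^sup>2 + \<alpha> * L * (t - 1)" for t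
  proof -
    have "(t - z1) * (t - z2) = t\<^sup>2 - (z1 + z2) * t + z1 * z2" by (simp add: power2_eq_square algebra_simps)
    then show ?thesis unfolding z_sum z_prod P_def q_def by (simp add: power2_eq_square algebra_simps)
  qed
  have "(- r - z1) * (- r - z2) < 0"
    unfolding fac using neg by (simp add: power2_eq_square algebra_simps)
  then have "z1 < - r" using z_le by (auto simp: mult_less_0_iff)
  then have z1: "r \<le> \<bar>z1\<bar>" by simp
  \<comment> \<open>Removing the component of the larger root \<open>z2\<close> leaves a purely geometric sequence with ratio \<open>z1\<close>.\<close>
  define u where "u k = c (Suc k) - z2 * c k" for k
  have u_Suc: "u (Suc k) = z1 * u k" for k
  proof -
    have "u (Suc k) = - P * c (Suc k) - q * c k - z2 * c (Suc k)" by (simp add: u_def rec)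
    also have "\<dots> = (- P - z2) * c (Suc k) - (z1 * z2) * c k" by (simp add: z_prod left_diff_distrib)
    also have "- P - z2 = z1" using z_sum by simp
    finally show ?thesis by (simp add: u_def algebra_simps)
  qed
  have u: "u k = z1 ^ k * u 0" for k by (induction k) (simp_all add: u_Suc)
  have "(\<lambda>k. r * (inverse (r ^ Suc k) * c (Suc k)) - z2 * (inverse (r ^ k) * c k)) \<longlonglongrightarrow> r * 0 - z2 * 0"
    by (intro tendsto_intros c_lim LIMSEQ_Suc[OF c_lim])
  moreover have "r * (inverse (r ^ Suc k) * c (Suc k)) - z2 * (inverse (r ^ k) * c k) = inverse (r ^ k) * (z1 ^ k * u 0)" for k
    using r(2) unfolding u[symmetric] by (simp add: u_def field_simps)
  ultimately have "(\<lambda>k. inverse (r ^ k) * (z1 ^ k * u 0)) \<longlonglongrightarrow> 0" by simp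
  then have "u 0 = 0" by (rule geometric_not_null[OF r(2) z1])
  then have z2: "z2 = - \<sigma> - \<alpha> * L" using c_Suc[of 0] by (simp add: u_def c0)
  have "(z2 + \<sigma>)\<^sup>2 + \<alpha> * L * (z2 - 1) = 0" using fac[of z2] by simp
  then have "(- (\<alpha> * L))\<^sup>2 + \<alpha> * L * (- \<sigma> - \<alpha> * L - 1) = 0" unfolding z2 by simp
  then have "\<alpha> * L * (\<sigma> + 1) = 0" by (simp add: power2_eq_square algebra_simps)
  then show False using \<alpha> h \<sigma> by simp
qed

section \<open>The optimal rate\<close>

text \<open>
  The equation is quadratic in \<open>g\<close>, and \<open>g\<close> is its larger root. The other two claims follow by
  comparing the square root in \<open>g\<close> with the values that correspond to \<open>\<sigma>\<close> and \<open>1\<close>.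
\<close>

lemma optimal_rate_facts:
  fixes \<rho> \<sigma> g :: real
  assumes "0 < \<rho>" "0 \<le> \<sigma>" "\<sigma> < 1"
  defines "g \<equiv> (\<sigma> * \<rho> + sqrt (1 + \<rho> - \<sigma>\<^sup>2 * \<rho>)) / (1 + \<rho>)"
  shows "1 - g\<^sup>2 = \<rho> * (g - \<sigma>)\<^sup>2" and "\<sigma> < g" and "g < 1"
proof -
  define s where "s = sqrt (1 + \<rho> - \<sigma>\<^sup>2 * \<rho>)"
  have \<sigma>2: "\<sigma>\<^sup>2 < 1" using assms by (simp add: power_less_one_iff abs_square_less_1)
  have "\<sigma>\<^sup>2 * \<rho> \<le> 1 * \<rho>" using \<sigma>2 assms by (intro mult_right_mono) auto
  then have rad: "0 \<le> 1 + \<rho> - \<sigma>\<^sup>2 * \<rho>" by simp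
  have s2: "s\<^sup>2 = 1 + \<rho> - \<sigma>\<^sup>2 * \<rho>" using rad by (simp add: s_def)
  have gs: "g * (1 + \<rho>) = \<sigma> * \<rho> + s" using assms by (simp add: g_def s_def)
  have "\<sigma> < s"
    unfolding s_def
  proof (rule real_less_rsqrt)
    have "(1 + \<rho>) * \<sigma>\<^sup>2 < (1 + \<rho>) * 1" using \<sigma>2 assms by (intro mult_strict_left_mono) auto
    then show "\<sigma>\<^sup>2 < 1 + \<rho> - \<sigma>\<^sup>2 * \<rho>" by (simp add: algebra_simps)
  qed
  then have "\<sigma> * (1 + \<rho>) < g * (1 + \<rho>)" unfolding gs by (simp add: algebra_simps)
  then show "\<sigma> < g" using assms(1) by simp
  have "s < 1 + \<rho> - \<sigma> * \<rho>"
  proof (rule power_less_imp_less_base[of _ 2])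
    have "\<sigma> * \<rho> \<le> 1 * \<rho>" using assms by (intro mult_right_mono) auto
    then show "0 \<le> 1 + \<rho> - \<sigma> * \<rho>" by simp
    have "(1 + \<rho> - \<sigma> * \<rho>)\<^sup>2 - s\<^sup>2 = \<rho> * (1 + \<rho>) * (1 - \<sigma>)\<^sup>2"
      unfolding s2 by (simp add: power2_eq_square algebra_simps)
    moreover have "\<rho> * (1 + \<rho>) * (1 - \<sigma>)\<^sup>2 > 0" using assms by simp
    ultimately show "s\<^sup>2 < (1 + \<rho> - \<sigma> * \<rho>)\<^sup>2" by simp
  qed
  then have "g * (1 + \<rho>) < 1 * (1 + \<rho>)" unfolding gs by simp
  then show "g < 1" using assms(1) by simp
  have "s = g * (1 + \<rho>) - \<sigma> * \<rho>" using gs by simp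
  then have "(g * (1 + \<rho>) - \<sigma> * \<rho>)\<^sup>2 = 1 + \<rho> - \<sigma>\<^sup>2 * \<rho>" using s2 by simp
  then have "(1 + \<rho>) * (1 - g\<^sup>2) = (1 + \<rho>) * (\<rho> * (g - \<sigma>)\<^sup>2)"
    by (simp add: power2_eq_square algebra_simps)
  then show "1 - g\<^sup>2 = \<rho> * (g - \<sigma>)\<^sup>2" using assms(1) by simp
qed

text \<open>
  Decay like \<open>t ^ k\<close> for some \<open>t\<close> strictly between \<open>g\<close> and \<open>r\<close> suffices. For such \<open>t\<close> the two
  inequalities that hold with equality at \<open>g\<close> become strict, because from \<open>g\<close> to \<open>t\<close> the quantity
  \<open>(t - \<sigma>)\<^sup>2\<close> grows at least by the square of the factor \<open>(1 + t) / (1 + g) > 1\<close> by which \<open>1 + t\<close> grows.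
\<close>

lemma DIGing_converges_at_critical_step:
  assumes N: "N \<ge> 2" and h: "0 < \<mu>" "\<mu> \<le> L" and \<sigma>: "0 \<le> \<sigma>" "\<sigma> < g" "g < 1" and \<alpha>: "0 < \<alpha>"
    and a: "\<alpha> * \<mu> = 1 - g" and b: "\<alpha> * L * (1 + g) = (g - \<sigma>)\<^sup>2"
  shows "DIGing_converges_at TYPE('a::euclidean_space) N \<mu> L \<sigma> \<alpha> g"
  unfolding DIGing_converges_at_def
proof (clarify, goal_cases)
  case (1 f Nb W x y xs r i)
  define t where "t = (g + r) / 2"
  have t: "g < t" "t < r" "t \<le> 1" "0 < t" "0 < r" using 1 \<sigma> by (auto simp: t_def)
  have small: "\<alpha> * L * (1 + t) < (t - \<sigma>)\<^sup>2"
  proof -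
    define q where "q = (1 + t) / (1 + g)"
    have q1: "1 < q" using t \<sigma> by (simp add: q_def)
    have "(g - \<sigma>) * q = (g - \<sigma>) + (g - \<sigma>) * (t - g) / (1 + g)"
      using \<sigma> by (simp add: q_def field_simps)
    also have "(g - \<sigma>) * (t - g) / (1 + g) \<le> (1 + g) * (t - g) / (1 + g)"
      using \<sigma> t by (intro divide_right_mono mult_right_mono) auto
    also have "\<dots> = t - g" using \<sigma> by simp
    finally have le: "(g - \<sigma>) * q \<le> t - \<sigma>" by simp
    have "\<alpha> * L * (1 + t) = (g - \<sigma>)\<^sup>2 * q" unfolding b[symmetric] q_def using \<sigma> by simp
    also have "\<dots> < (g - \<sigma>)\<^sup>2 * q\<^sup>2"
      using \<sigma> q1 by (intro mult_strict_left_mono) (auto simp: power2_eq_square)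
    also have "\<dots> = ((g - \<sigma>) * q)\<^sup>2" by (simp add: power_mult_distrib)
    also have "\<dots> \<le> (t - \<sigma>)\<^sup>2" using le \<sigma> q1 by (intro power_mono) auto
    finally show ?thesis .
  qed
  obtain C where C: "\<And>k. norm (x k i - xs) \<le> C * t ^ k"
    using DIGing_geometric_decay[OF _ 1(1) 1(2) 1(3) 1(4) \<alpha> h \<sigma>(1) _ t(3) _ small 1(6)] N \<sigma> t a
    by auto
  have "(\<lambda>k. C * (t / r) ^ k) \<longlonglongrightarrow> C * 0"
    using t by (intro tendsto_mult tendsto_const LIMSEQ_power_zero) auto
  then have null: "(\<lambda>k. C * (t / r) ^ k) \<longlonglongrightarrow> 0" by simp
  have le: "norm (inverse (r ^ k) *\<^sub>R (x k i - xs)) \<le> C * (t / r) ^ k" for k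
  proof -
    have "norm (inverse (r ^ k) *\<^sub>R (x k i - xs)) = norm (x k i - xs) / r ^ k"
      using t unfolding norm_scaleR by (simp add: divide_inverse mult.commute)
    also have "\<dots> \<le> C * t ^ k / r ^ k" using C[of k] t by (intro divide_right_mono) auto
    finally show ?thesis by (simp add: power_divide)
  qed
  show ?case by (rule Lim_null_comparison[OF _ null]) (simp only: le eventually_True)
qed

theorem theorem1:
  fixes N :: nat and \<mu> L \<sigma> \<rho> \<gamma>_opt \<alpha>_opt :: real
  assumes "N \<ge> 2"
    and "0 < \<mu>" and "\<mu> \<le> L"
    and "0 \<le> \<sigma>" and "\<sigma> < 1"
  defines "\<rho> \<equiv> \<mu> / L"
  defines "\<gamma>_opt \<equiv> (\<sigma> * \<rho> + sqrt (1 + \<rho> - \<sigma>\<^sup>2 * \<rho>)) / (1 + \<rho>)"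
  defines "\<alpha>_opt \<equiv> (1 - \<gamma>_opt) / \<mu>"
  shows "\<alpha>_opt > 0
    \<and> DIGing_rate TYPE('a::euclidean_space) N \<mu> L \<sigma> \<alpha>_opt = \<gamma>_opt
    \<and> (\<forall>\<alpha>>0. \<gamma>_opt \<le> DIGing_rate TYPE('a) N \<mu> L \<sigma> \<alpha>)"
proof -
  have L: "0 < L" and \<rho>: "0 < \<rho>" using assms(2,3) by (auto simp: \<rho>_def)
  note g = optimal_rate_facts[OF \<rho> assms(4,5), folded \<gamma>_opt_def]
  have g0: "0 < \<gamma>_opt" using g(2) assms(4) by simp
  have \<alpha>: "0 < \<alpha>_opt" using g(3) assms(2) by (simp add: \<alpha>_opt_def)
  have a: "\<alpha>_opt * \<mu> = 1 - \<gamma>_opt" using assms(2) by (simp add: \<alpha>_opt_def)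
  have b: "\<alpha>_opt * L * (1 + \<gamma>_opt) = (\<gamma>_opt - \<sigma>)\<^sup>2"
  proof -
    have "\<alpha>_opt * L * (1 + \<gamma>_opt) = (1 - \<gamma>_opt\<^sup>2) / \<rho>"
      using assms(2) L by (simp add: \<alpha>_opt_def \<rho>_def field_simps power2_eq_square)
    also have "\<dots> = (\<gamma>_opt - \<sigma>)\<^sup>2" using \<rho> by (simp add: g(1))
    finally show ?thesis .
  qed
  have lower: "\<gamma>_opt \<le> DIGing_rate TYPE('a) N \<mu> L \<sigma> \<alpha>" if \<alpha>0: "0 < \<alpha>" for \<alpha>
  proof (cases "\<exists>\<gamma>\<in>{0..<1}. DIGing_converges_at TYPE('a) N \<mu> L \<sigma> \<alpha> \<gamma>")
    case False
    then show ?thesis using g(3) by (simp add: DIGing_rate_def)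
  next
    case True
    then have conv: "DIGing_converges_at TYPE('a) N \<mu> L \<sigma> \<alpha> (DIGing_rate TYPE('a) N \<mu> L \<sigma> \<alpha>)"
      by (auto intro: DIGing_rate_least(2))
    show ?thesis
    proof (rule ccontr)
      assume "\<not> ?thesis"
      then have lt: "DIGing_rate TYPE('a) N \<mu> L \<sigma> \<alpha> < \<gamma>_opt" by simp
      have "\<bar>1 - \<alpha> * \<mu>\<bar> < \<gamma>_opt"
        using consensus_mode_bound[OF conv assms(1,4,5,2,3) lt g0] g(3) by simp
      then have "\<alpha>_opt * \<mu> < \<alpha> * \<mu>" unfolding a by linarith
      then have "\<alpha>_opt < \<alpha>" using assms(2) by simp
      then have "\<alpha>_opt * L * (1 + \<gamma>_opt) < \<alpha> * L * (1 + \<gamma>_opt)" using L g0 by simp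
      moreover have "\<alpha> * L * (1 + \<gamma>_opt) \<le> (\<gamma>_opt - \<sigma>)\<^sup>2"
        using alternating_mode_bound[OF conv assms(1,4,5,2,3) \<alpha>0 lt g0] g(3) by simp
      ultimately show False using b by simp
    qed
  qed
  have "DIGing_converges_at TYPE('a) N \<mu> L \<sigma> \<alpha>_opt \<gamma>_opt"
    by (rule DIGing_converges_at_critical_step[OF assms(1-4) g(2,3) \<alpha> a b])
  then have "DIGing_rate TYPE('a) N \<mu> L \<sigma> \<alpha>_opt \<le> \<gamma>_opt"
    using g0 g(3) by (intro DIGing_rate_least(3)) auto
  then show ?thesis using lower \<alpha> by (auto intro: antisym)
qed

end
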